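(* The map $\varphi: H^*_T(G/B) \rightarrow H^*_T(G/P)$ that sends the class $p = (p(v))_{v \in W}$ to $\varphi(p) = (p(v))_{v \in W^J}$ restricts to an $S(\mathfrak{t}^* )$-algebra isomorphism on the $S(\mathfrak{t}^* )$-span of $\{ p_w: w \in W^J \}$.
   Context: $G$ is a complex semisimple linear algebraic group, $T \subseteq B \subseteq P \subseteq G$ with $T$ a maximal torus, $B$ a Borel subgroup, $P$ a parabolic subgroup; $\mathfrak{t} = \mathrm{Lie}(T)$. $W=N(T)/T$ is the Weyl group, $\Delta^+$ the positive roots (those of $B$), $s_1,\dots,s_n$ the simple reflections with simple roots $\alpha_1,\dots,\alpha_n$, $s_\alpha$ the reflection in $\alpha$. $J \subseteq \{1,\dots,n\}$ is the subset corresponding to $P$ (so $i\in J$ iff $\mathfrak{g}_{-\alpha_i} \subseteq \mathrm{Lie}(P)$), $W_J = \langle s_i : i \in J\rangle$, $[w]=wW_J \in W/W_J$, and $W^J\subseteq W$ is the set of unique minimal-length coset representatives. A tuple indexed by $W^J$ is regarded as a function on $W/W_J$ via the bijection $W^J \to W/W_J$, $v\mapsto [v]$. $S(\mathfrak{t}^* )$ is the symmetric algebra over $\mathbb{C}$. Cohomology has complex coefficients, and $H^*_T(G/P)$ is given in its GKM (Goresky-Kottwitz-MacPherson) presentation: it is the $S(\mathfrak{t}^* )$-algebra (coordinatewise operations) of functions $p : W/W_J \to S(\mathfrak{t}^* )$ such that $p([s_\alpha w]) - p([w]) \in (\alpha)$ for all $w \in W$ and $\alpha\in\Delta^+$ with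 $[s_\alpha w] \neq [w]$. The case $P=B$, $J=\emptyset$ gives $H^*_T(G/B)$, consisting of functions $W\to S(\mathfrak{t}^* )$. The flow-up (equivariant Schubert) class $p_w \in H^*_T(G/B)$ is the homogeneous class supported exactly on the $v\in W$ with $v \ge w$ in Bruhat order and with $p_w(w) = \prod_{\alpha \in \Delta^+,\, w^{-1}(\alpha)<0} \alpha$.
   Formalization: φ need not send all of H_T(G/B) into H_T(G/P) (for SL_3, J={1}, φ(p_{s_1}) violates the GKM condition), so φ is taken as a map of functions on W to functions on W/W_J; only its restriction to the span is claimed to land in H_T(G/P), where it is an S(t* )-algebra isomorphism onto it. *)

theory Defs
  imports Complex_Main "HOL-Library.FuncSet" "HOL-Algebra.Module" "HOL-Algebra.QuotRing"
    "HOL-Algebra.Bij" "HOL-Algebra.Generated_Groups"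
begin

section \<open>Semisimple root data\<close>

text \<open>
  The type \<open>'t\<close>, with scalar multiplication \<open>scale\<close>, is the complex vector space \<open>Lie(T)\<close>;
  \<open>roots\<close> are the roots of \<open>(G, T)\<close> as linear functionals on \<open>Lie(T)\<close>, \<open>coroot \<beta>\<close> is the coroot
  of \<open>\<beta>\<close> in \<open>Lie(T)\<close>, and \<open>simple 1, \<dots>, simple rank\<close> are the simple roots determined by \<open>B\<close>.
  A parabolic subgroup \<open>P\<close> containing \<open>B\<close> enters through the set \<open>J\<close> of those indices \<open>i\<close> for which
  the root space of minus the \<open>i\<close>-th simple root lies in \<open>Lie(P)\<close>; every subset of
  \<open>{1..rank}\<close> arises in this way.
\<close>

record 't root_data =
  scale :: "complex \<Rightarrow> 't \<Rightarrow> 't"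
  roots :: "('t \<Rightarrow> complex) set"
  coroot :: "('t \<Rightarrow> complex) \<Rightarrow> 't"
  rank :: nat
  simple :: "nat \<Rightarrow> 't \<Rightarrow> complex"

definition dual :: "('t::ab_group_add) root_data \<Rightarrow> ('t \<Rightarrow> complex) set"
  where "dual D = {l. Vector_Spaces.linear (scale D) (*) l}"

definition is_coroot :: "('t::ab_group_add) root_data \<Rightarrow> ('t \<Rightarrow> complex) \<Rightarrow> 't \<Rightarrow> bool"
  where "is_coroot D \<alpha> h \<longleftrightarrow> \<alpha> h = 2 \<and>
    (\<forall>\<beta>\<in>roots D. \<beta> h \<in> \<int> \<and> (\<lambda>x. \<beta> x - \<beta> h * \<alpha> x) \<in> roots D)"

text \<open>
  A reduced crystallographic root system in the dual of the vector space, together with a base.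
  That the finitely many roots span the dual is semisimplicity (as opposed to reductivity); it also
  makes the vector space finite-dimensional and the coroots unique. The rank may be \<open>0\<close>.
\<close>

definition semisimple_root_data :: "('t::ab_group_add) root_data \<Rightarrow> bool"
  where "semisimple_root_data D \<longleftrightarrow>
    vector_space (scale D) \<and>
    finite (roots D) \<and> roots D \<subseteq> dual D \<and> (\<lambda>_. 0) \<notin> roots D \<and>
    (\<forall>l\<in>dual D. \<exists>c. l = (\<lambda>h. \<Sum>\<beta>\<in>roots D. c \<beta> * \<beta> h)) \<and>
    (\<forall>\<alpha>\<in>roots D. is_coroot D \<alpha> (coroot D \<alpha>)) \<and>
    (\<forall>\<alpha>\<in>roots D. \<forall>c. (\<lambda>h. c * \<alpha> h) \<in> roots D \<longrightarrow> c = 1 \<or> c = - 1) \<and>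
    simple D ` {1..rank D} \<subseteq> roots D \<and>
    (\<forall>c. (\<forall>h. (\<Sum>i=1..rank D. c i * simple D i h) = 0) \<longrightarrow> (\<forall>i\<in>{1..rank D}. c i = 0)) \<and>
    (\<forall>\<beta>\<in>roots D. \<exists>c :: nat \<Rightarrow> nat.
        \<beta> = (\<lambda>h. \<Sum>i=1..rank D. of_nat (c i) * simple D i h) \<or>
        \<beta> = (\<lambda>h. - (\<Sum>i=1..rank D. of_nat (c i) * simple D i h)))"

definition pos_roots :: "('t::ab_group_add) root_data \<Rightarrow> ('t \<Rightarrow> complex) set"
  where "pos_roots D =
    {\<beta> \<in> roots D. \<exists>c :: nat \<Rightarrow> nat. \<beta> = (\<lambda>h. \<Sum>i=1..rank D. of_nat (c i) * simple D i h)}"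


section \<open>The Weyl group\<close>

text \<open>
  The Weyl group is taken in its (faithful) action on \<open>Lie(T)\<close>; hence \<open>w\<^sup>-\<^sup>1(\<alpha>)\<close> is the functional
  \<open>\<lambda>h. \<alpha> (w h)\<close>.
\<close>

definition reflection :: "('t::ab_group_add) root_data \<Rightarrow> ('t \<Rightarrow> complex) \<Rightarrow> 't \<Rightarrow> 't"
  where "reflection D \<beta> h = h - scale D (\<beta> h) (coroot D \<beta>)"

definition Weyl :: "('t::ab_group_add) root_data \<Rightarrow> ('t \<Rightarrow> 't) set"
  where "Weyl D = generate (BijGroup UNIV) (reflection D ` roots D)"

definition parabolic_Weyl :: "('t::ab_group_add) root_data \<Rightarrow> nat set \<Rightarrow> ('t \<Rightarrow> 't) set"
  where "parabolic_Weyl D J = generate (BijGroup UNIV) ((\<lambda>j. reflection D (simple D j)) ` J)"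

definition word :: "('t::ab_group_add) root_data \<Rightarrow> nat list \<Rightarrow> 't \<Rightarrow> 't"
  where "word D js = foldr (\<lambda>j w. reflection D (simple D j) \<circ> w) js id"

text \<open>Reflections are involutions, so products of simple reflections need no inverses.\<close>

definition len :: "('t::ab_group_add) root_data \<Rightarrow> ('t \<Rightarrow> 't) \<Rightarrow> nat"
  where "len D w = (LEAST k. \<exists>js. length js = k \<and> set js \<subseteq> {1..rank D} \<and> w = word D js)"

definition Bruhat_step :: "('t::ab_group_add) root_data \<Rightarrow> ('t \<Rightarrow> 't) \<Rightarrow> ('t \<Rightarrow> 't) \<Rightarrow> bool"
  where "Bruhat_step D u v \<longleftrightarrow> u \<in> Weyl D \<and>
    (\<exists>\<beta>\<in>pos_roots D. v = reflection D \<beta> \<circ> u \<and> len D u < len D v)"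

definition Bruhat_le :: "('t::ab_group_add) root_data \<Rightarrow> ('t \<Rightarrow> 't) \<Rightarrow> ('t \<Rightarrow> 't) \<Rightarrow> bool"
  where "Bruhat_le D = (Bruhat_step D)\<^sup>*\<^sup>*"

definition coset :: "('t::ab_group_add) root_data \<Rightarrow> nat set \<Rightarrow> ('t \<Rightarrow> 't) \<Rightarrow> ('t \<Rightarrow> 't) set"
  where "coset D J w = {w \<circ> u | u. u \<in> parabolic_Weyl D J}"

definition min_reps :: "('t::ab_group_add) root_data \<Rightarrow> nat set \<Rightarrow> ('t \<Rightarrow> 't) set"
  where "min_reps D J = {w \<in> Weyl D. \<forall>v\<in>coset D J w. len D w \<le> len D v}"


section \<open>The symmetric algebra of the dual\<close>

text \<open>
  As the ground field is infinite, the symmetric algebra of the dual is the ring of polynomial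
  functions on \<open>Lie(T)\<close>, that is, the algebra of functions generated by the linear functionals.
\<close>

inductive_set poly_funs :: "('t::ab_group_add) root_data \<Rightarrow> ('t \<Rightarrow> complex) set"
  for D :: "'t root_data"
  where
    const: "(\<lambda>_. c) \<in> poly_funs D"
  | functional: "l \<in> dual D \<Longrightarrow> l \<in> poly_funs D"
  | add: "f \<in> poly_funs D \<Longrightarrow> g \<in> poly_funs D \<Longrightarrow> (\<lambda>h. f h + g h) \<in> poly_funs D"
  | mult: "f \<in> poly_funs D \<Longrightarrow> g \<in> poly_funs D \<Longrightarrow> (\<lambda>h. f h * g h) \<in> poly_funs D"

definition Sym :: "('t::ab_group_add) root_data \<Rightarrow> ('t \<Rightarrow> complex) ring"
  where "Sym D =
    \<lparr>carrier = poly_funs D, mult = (\<lambda>f g h. f h * g h), one = (\<lambda>_. 1),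
     zero = (\<lambda>_. 0), add = (\<lambda>f g h. f h + g h)\<rparr>"

definition homogeneous :: "('t::ab_group_add) root_data \<Rightarrow> nat \<Rightarrow> ('t \<Rightarrow> complex) \<Rightarrow> bool"
  where "homogeneous D d f \<longleftrightarrow> (\<forall>c h. f (scale D c h) = c ^ d * f h)"


section \<open>Equivariant cohomology in the GKM presentation\<close>

text \<open>
  Classes are functions on a vertex set \<open>X\<close> onto which the Weyl group is mapped by \<open>\<pi>\<close>.
  For \<open>G/P\<close> this is the quotient map to \<open>W/W\<^sub>J\<close>; for \<open>G/B\<close> it is the identity of \<open>W\<close>, that is, the
  singleton cosets of the trivial group are identified with their elements.
\<close>

definition GKM ::
    "('t::ab_group_add) root_data \<Rightarrow> 'x set \<Rightarrow> (('t \<Rightarrow> 't) \<Rightarrow> 'x) \<Rightarrow>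
      ('t \<Rightarrow> complex, 'x \<Rightarrow> 't \<Rightarrow> complex) module"
  where "GKM D X \<pi> =
    \<lparr>carrier = {p \<in> X \<rightarrow>\<^sub>E carrier (Sym D).
        \<forall>w\<in>Weyl D. \<forall>\<alpha>\<in>pos_roots D. \<pi> (reflection D \<alpha> \<circ> w) \<noteq> \<pi> w \<longrightarrow>
          p (\<pi> (reflection D \<alpha> \<circ> w)) \<ominus>\<^bsub>Sym D\<^esub> p (\<pi> w) \<in> PIdl\<^bsub>Sym D\<^esub> \<alpha>},
     mult = (\<lambda>p q. \<lambda>x\<in>X. p x \<otimes>\<^bsub>Sym D\<^esub> q x),
     one = (\<lambda>x\<in>X. \<one>\<^bsub>Sym D\<^esub>),
     zero = (\<lambda>x\<in>X. \<zero>\<^bsub>Sym D\<^esub>),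
     add = (\<lambda>p q. \<lambda>x\<in>X. p x \<oplus>\<^bsub>Sym D\<^esub> q x),
     smult = (\<lambda>c p. \<lambda>x\<in>X. c \<otimes>\<^bsub>Sym D\<^esub> p x)\<rparr>"

definition HT_GB ::
    "('t::ab_group_add) root_data \<Rightarrow> ('t \<Rightarrow> complex, ('t \<Rightarrow> 't) \<Rightarrow> 't \<Rightarrow> complex) module"
  where "HT_GB D = GKM D (Weyl D) (\<lambda>w. w)"

definition HT_GP ::
    "('t::ab_group_add) root_data \<Rightarrow> nat set \<Rightarrow>
      ('t \<Rightarrow> complex, ('t \<Rightarrow> 't) set \<Rightarrow> 't \<Rightarrow> complex) module"
  where "HT_GP D J = GKM D (coset D J ` Weyl D) (coset D J)"

definition is_flow_up ::
    "('t::ab_group_add) root_data \<Rightarrow> ('t \<Rightarrow> 't) \<Rightarrow> (('t \<Rightarrow> 't) \<Rightarrow> 't \<Rightarrow> complex) \<Rightarrow> bool"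
  where "is_flow_up D w p \<longleftrightarrow>
    p \<in> carrier (HT_GB D) \<and>
    (\<exists>d. \<forall>v\<in>Weyl D. homogeneous D d (p v)) \<and>
    (\<forall>v\<in>Weyl D. p v \<noteq> \<zero>\<^bsub>Sym D\<^esub> \<longleftrightarrow> Bruhat_le D w v) \<and>
    p w = (\<lambda>h. \<Prod>\<alpha> | \<alpha> \<in> pos_roots D \<and> (\<lambda>x. - \<alpha> (w x)) \<in> pos_roots D. \<alpha> h)"

text \<open>At most one class satisfies these conditions, which justifies the use of \<open>THE\<close>.\<close>

definition flow_up ::
    "('t::ab_group_add) root_data \<Rightarrow> ('t \<Rightarrow> 't) \<Rightarrow> ('t \<Rightarrow> 't) \<Rightarrow> 't \<Rightarrow> complex"
  where "flow_up D w = (THE p. is_flow_up D w p)"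

text \<open>
  The tuple of values at the minimal representatives, as a function on \<open>W/W\<^sub>J\<close>. It is defined on
  arbitrary functions on \<open>W\<close>: for a general class \<open>p\<close> of \<open>G/B\<close> the result need not satisfy
  the GKM conditions of \<open>G/P\<close>.
\<close>

definition restrict_reps ::
    "('t::ab_group_add) root_data \<Rightarrow> nat set \<Rightarrow> (('t \<Rightarrow> 't) \<Rightarrow> 't \<Rightarrow> complex) \<Rightarrow>
      ('t \<Rightarrow> 't) set \<Rightarrow> 't \<Rightarrow> complex"
  where "restrict_reps D J p =
    (\<lambda>C\<in>coset D J ` Weyl D. p (the_inv_into (min_reps D J) (coset D J) C))"


section \<open>Spans and isomorphisms of algebras\<close>

definition module_span :: "('a, 'r) ring_scheme \<Rightarrow> ('a, 'b, 'm) module_scheme \<Rightarrow> 'b set \<Rightarrow> 'b set"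
  where "module_span R M X = \<Inter>{N. submodule N R M \<and> X \<subseteq> N}"

definition algebra_iso ::
    "('a, 'r) ring_scheme \<Rightarrow> ('a, 'b, 'm) module_scheme \<Rightarrow> ('a, 'c, 'n) module_scheme \<Rightarrow> ('b \<Rightarrow> 'c) set"
  where "algebra_iso R A B =
    {f \<in> ring_iso A B. \<forall>c\<in>carrier R. \<forall>x\<in>carrier A. f (c \<odot>\<^bsub>A\<^esub> x) = c \<odot>\<^bsub>B\<^esub> f x}"

definition flow_up_span ::
    "('t::ab_group_add) root_data \<Rightarrow> nat set \<Rightarrow>
      ('t \<Rightarrow> complex, ('t \<Rightarrow> 't) \<Rightarrow> 't \<Rightarrow> complex) module"
  where "flow_up_span D J =
    HT_GB D\<lparr>carrier := module_span (Sym D) (HT_GB D) (flow_up D ` min_reps D J)\<rparr>"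

end

theory Submission
  imports Defs "HOL-Computational_Algebra.Polynomial"
begin

text \<open>
  Pulling functions back along \<open>W \<rightarrow> W/W\<^sub>J\<close> identifies the classes of \<open>G/P\<close> with the classes of \<open>G/B\<close>
  that are invariant under right multiplication by \<open>W\<^sub>J\<close>, and on those the tuple of values at the
  minimal representatives is the inverse of the pull-back. Both maps are coordinatewise, so they
  respect all operations. What has to be shown is that the span of the \<open>p\<^sub>w\<close> with \<open>w \<in> W\<^sup>J\<close> is exactly
  the algebra of invariant classes (\<open>module_span_flow_up\<close>).

  One inclusion says that \<open>p\<^sub>w\<close> does not change under a right simple reflection \<open>s\<^sub>i\<close> with
  \<open>w s\<^sub>i > w\<close> (\<open>schubert_class_ascent\<close>). The difference \<open>p\<^sub>w(v) - p\<^sub>w(v s\<^sub>i)\<close> is a class whose value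
  at a shortest \<open>v\<close> of its support is divisible by one root for each inversion of \<open>v\<close> and, by
  antisymmetry, by \<open>v(\<alpha>\<^sub>i)\<close>. This exceeds the degree, as \<open>p\<^sub>w\<close> is supported on long elements.

  For the other inclusion (\<open>invariant_in_submodule\<close>) take a shortest \<open>v\<close> in the support of an
  invariant class \<open>q\<close>. Invariance makes \<open>v\<close> a minimal representative, and the conditions on classes
  make \<open>q(v)\<close> a multiple of \<open>p\<^sub>v(v)\<close>; subtracting that multiple of \<open>p\<^sub>v\<close> pushes the support up in the
  Bruhat order. Minimal representatives are unique because \<open>p\<^sub>w\<close> is constant, and thus nonzero, on
  \<open>w W\<^sub>J\<close>, so that \<open>w\<close> lies below its whole coset.

  All this presupposes that the flow-up classes exist. They are built by descending induction on
  the length, by right divided differences, starting from the class of a point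
  (\<open>schubert_class_exists\<close>). That their support is the whole upper interval follows from
  the recursion \<open>schubert_class_descent\<close> for their values: it writes them as sums of products of
  positive roots, which cannot cancel at a point where every positive root is positive. The
  theory of the Weyl group that is used (generation by simple reflections, strong exchange, length
  as number of inversions, lifting property of the Bruhat order) is derived from the axioms of
  root data.
\<close>

locale semisimple_roots =
  fixes D :: "('t::ab_group_add) root_data"
  assumes semisimple: "semisimple_root_data D"
begin

section \<open>Linear functionals and the root system\<close>

abbreviation simple_indices :: "nat set" where "simple_indices \<equiv> {1..rank D}"
abbreviation simple_refl :: "nat \<Rightarrow> 't \<Rightarrow> 't" where "simple_refl i \<equiv> reflection D (simple D i)"

lemma vector_space_D: "vector_space (scale D)"
  using semisimple[unfolded semisimple_root_data_def] by (elim conjE)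

lemma vector_space_complex: "vector_space ((*) :: complex \<Rightarrow> complex \<Rightarrow> complex)"
  by unfold_locales (auto simp: algebra_simps)

lemma dual_iff: "l \<in> dual D \<longleftrightarrow> (\<forall>x y. l (x + y) = l x + l y) \<and> (\<forall>c x. l (scale D c x) = c * l x)"
  unfolding dual_def
  by (simp add: Vector_Spaces.linear_iff vector_space_D vector_space_complex)

lemma dual_add: "l \<in> dual D \<Longrightarrow> l (x + y) = l x + l y"
  and dual_scale: "l \<in> dual D \<Longrightarrow> l (scale D c x) = c * l x"
  by (simp_all add: dual_iff)

lemma dual_zero: "l \<in> dual D \<Longrightarrow> l 0 = 0"
  using dual_add[of l 0 0] by simp

lemma dual_diff: "l \<in> dual D \<Longrightarrow> l (x - y) = l x - l y"
  using dual_add[of l "x - y" y] by simp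

lemma dual_sum: "l \<in> dual D \<Longrightarrow> l (\<Sum>a\<in>A. f a) = (\<Sum>a\<in>A. l (f a))"
  by (induction A rule: infinite_finite_induct) (simp_all add: dual_zero dual_add)

lemma finite_roots: "finite (roots D)"
  and roots_dual: "\<beta> \<in> roots D \<Longrightarrow> \<beta> \<in> dual D"
  and zero_not_root: "(\<lambda>_. 0) \<notin> roots D"
  and simple_root: "i \<in> simple_indices \<Longrightarrow> simple D i \<in> roots D"
  and coroot_is_coroot: "\<beta> \<in> roots D \<Longrightarrow> is_coroot D \<beta> (coroot D \<beta>)"
  and roots_reduced: "\<beta> \<in> roots D \<Longrightarrow> (\<lambda>h. c * \<beta> h) \<in> roots D \<Longrightarrow> c = 1 \<or> c = - 1"
  and roots_span: "l \<in> dual D \<Longrightarrow> \<exists>c. l = (\<lambda>h. \<Sum>\<beta>\<in>roots D. c \<beta> * \<beta> h)"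
proof -
  note parts = semisimple[unfolded semisimple_root_data_def]
  show "finite (roots D)" using parts by (elim conjE)
  show "(\<lambda>_. 0) \<notin> roots D" using parts by (elim conjE)
  have "roots D \<subseteq> dual D" using parts by (elim conjE)
  then show "\<beta> \<in> roots D \<Longrightarrow> \<beta> \<in> dual D" by (rule subsetD)
  have "simple D ` simple_indices \<subseteq> roots D" using parts by (elim conjE)
  then show "i \<in> simple_indices \<Longrightarrow> simple D i \<in> roots D" by (rule subsetD) (rule imageI)
  have "\<forall>\<alpha>\<in>roots D. is_coroot D \<alpha> (coroot D \<alpha>)" using parts by (elim conjE)
  then show "\<beta> \<in> roots D \<Longrightarrow> is_coroot D \<beta> (coroot D \<beta>)" by (rule bspec)
  have "\<forall>\<alpha>\<in>roots D. \<forall>c. (\<lambda>h. c * \<alpha> h) \<in> roots D \<longrightarrow> c = 1 \<or> c = - 1" using parts by (elim conjE)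
  then show "\<beta> \<in> roots D \<Longrightarrow> (\<lambda>h. c * \<beta> h) \<in> roots D \<Longrightarrow> c = 1 \<or> c = - 1" by simp
  have "\<forall>l\<in>dual D. \<exists>c. l = (\<lambda>h. \<Sum>\<beta>\<in>roots D. c \<beta> * \<beta> h)" using parts by (elim conjE)
  then show "l \<in> dual D \<Longrightarrow> \<exists>c. l = (\<lambda>h. \<Sum>\<beta>\<in>roots D. c \<beta> * \<beta> h)" by (rule bspec)
qed

lemmas root_add = dual_add[OF roots_dual]
  and root_scale = dual_scale[OF roots_dual]
  and root_diff = dual_diff[OF roots_dual]

lemma simple_independent:
  assumes "\<And>h. (\<Sum>i\<in>simple_indices. c i * simple D i h) = 0" "i \<in> simple_indices"
  shows "c i = 0"
proof -
  have "\<forall>c. (\<forall>h. (\<Sum>i\<in>simple_indices. c i * simple D i h) = 0) \<longrightarrow> (\<forall>i\<in>simple_indices. c i = 0)"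
    using semisimple[unfolded semisimple_root_data_def] by (elim conjE)
  then show ?thesis using assms by simp
qed

lemma root_decomposition:
  assumes "\<beta> \<in> roots D"
  obtains c :: "nat \<Rightarrow> nat" where "\<beta> = (\<lambda>h. \<Sum>i\<in>simple_indices. of_nat (c i) * simple D i h)"
  | c :: "nat \<Rightarrow> nat" where "\<beta> = (\<lambda>h. - (\<Sum>i\<in>simple_indices. of_nat (c i) * simple D i h))"
proof -
  have "\<forall>\<beta>\<in>roots D. \<exists>c :: nat \<Rightarrow> nat.
        \<beta> = (\<lambda>h. \<Sum>i\<in>simple_indices. of_nat (c i) * simple D i h) \<or>
        \<beta> = (\<lambda>h. - (\<Sum>i\<in>simple_indices. of_nat (c i) * simple D i h))"
    using semisimple[unfolded semisimple_root_data_def] by (elim conjE)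
  then show thesis using assms that by meson
qed

lemma root_coroot: "\<beta> \<in> roots D \<Longrightarrow> \<beta> (coroot D \<beta>) = 2"
  and root_coroot_Ints: "\<alpha> \<in> roots D \<Longrightarrow> \<beta> \<in> roots D \<Longrightarrow> \<beta> (coroot D \<alpha>) \<in> \<int>"
  using coroot_is_coroot by (auto simp: is_coroot_def)

lemma reflection_functional:
  assumes "l \<in> dual D"
  shows "l (reflection D \<beta> h) = l h - \<beta> h * l (coroot D \<beta>)"
  by (simp add: reflection_def dual_diff[OF assms] dual_scale[OF assms])

lemma root_reflection: "\<alpha> \<in> roots D \<Longrightarrow> \<beta> \<in> roots D \<Longrightarrow> \<beta> \<circ> reflection D \<alpha> \<in> roots D"
  using coroot_is_coroot[of \<alpha>]
  by (auto simp: is_coroot_def comp_def reflection_functional[OF roots_dual] mult.commute)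

lemma root_reflection_self: "\<beta> \<in> roots D \<Longrightarrow> \<beta> \<circ> reflection D \<beta> = (\<lambda>h. - \<beta> h)"
  by (auto simp: fun_eq_iff reflection_functional[OF roots_dual] root_coroot)

lemma root_neg: "\<beta> \<in> roots D \<Longrightarrow> (\<lambda>h. - \<beta> h) \<in> roots D"
  using root_reflection[of \<beta> \<beta>] by (simp add: root_reflection_self)

lemma scale_zero_left: "scale D 0 x = 0"
  and scale_minus_left: "scale D (- c) x = - scale D c x"
  and scale_add_left: "scale D (c + d) x = scale D c x + scale D d x"
proof -
  interpret vector_space "scale D" by (rule vector_space_D)
  show "scale D 0 x = 0" "scale D (- c) x = - scale D c x"
    "scale D (c + d) x = scale D c x + scale D d x"
    by (simp_all add: algebra_simps)
qed

lemma reflection_involution: "\<beta> \<in> roots D \<Longrightarrow> reflection D \<beta> \<circ> reflection D \<beta> = id"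
  by (auto simp: fun_eq_iff reflection_functional[OF roots_dual] root_coroot reflection_def
      root_diff root_scale scale_minus_left)

lemma reflection_reflection: "\<beta> \<in> roots D \<Longrightarrow> reflection D \<beta> (reflection D \<beta> h) = h"
  using reflection_involution[of \<beta>] by (simp add: fun_eq_iff)

lemma reflection_comp_cancel: "\<beta> \<in> roots D \<Longrightarrow> reflection D \<beta> \<circ> (reflection D \<beta> \<circ> w) = w"
  "\<beta> \<in> roots D \<Longrightarrow> f \<circ> reflection D \<beta> \<circ> reflection D \<beta> = f"
  by (simp_all add: fun_eq_iff reflection_reflection)

lemma bij_reflection: "\<beta> \<in> roots D \<Longrightarrow> bij (reflection D \<beta>)"
  by (rule o_bij[of "reflection D \<beta>"]) (simp_all add: reflection_involution)

lemma reflection_add: "\<beta> \<in> roots D \<Longrightarrow> reflection D \<beta> (x + y) = reflection D \<beta> x + reflection D \<beta> y"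
  by (simp add: reflection_def root_add scale_add_left)

lemma reflection_scale: "\<beta> \<in> roots D \<Longrightarrow> reflection D \<beta> (scale D c x) = scale D c (reflection D \<beta> x)"
proof -
  assume "\<beta> \<in> roots D"
  interpret vector_space "scale D" by (rule vector_space_D)
  show ?thesis using \<open>\<beta> \<in> roots D\<close>
    by (simp add: reflection_def root_scale scale_right_diff_distrib)
qed

text \<open>
  The roots span the dual, and a nonzero vector is not annihilated by all functionals.
\<close>

lemma roots_separate:
  assumes "\<And>\<beta>. \<beta> \<in> roots D \<Longrightarrow> \<beta> x = \<beta> y"
  shows "x = y"
proof (rule ccontr)
  assume "x \<noteq> y"
  interpret vector_space_pair "scale D" "(*) :: complex \<Rightarrow> complex \<Rightarrow> complex"
    by (intro vector_space_pair.intro vector_space_D vector_space_complex)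
  have "vs1.independent {x - y}"
    using \<open>x \<noteq> y\<close> by simp
  from linear_independent_extend[OF this, of "\<lambda>_. 1"]
  obtain l where l: "l \<in> dual D" "l (x - y) = 1"
    by (auto simp: dual_def)
  from roots_span[OF l(1)] obtain c where c: "l = (\<lambda>h. \<Sum>\<beta>\<in>roots D. c \<beta> * \<beta> h)"
    by blast
  have "l (x - y) = 0"
    unfolding c by (rule sum.neutral) (use assms in \<open>simp add: root_diff\<close>)
  with l show False by simp
qed

text \<open>
  Two coroots of the same root give two reflections whose composite translates a root \<open>\<gamma>\<close> by
  multiples of \<open>\<alpha>\<close>; as there are finitely many roots, these translations are trivial.
\<close>

lemma coroot_unique:
  assumes "\<alpha> \<in> roots D" "is_coroot D \<alpha> h" "is_coroot D \<alpha> k"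
  shows "h = k"
proof (rule roots_separate)
  fix \<gamma> assume \<gamma>: "\<gamma> \<in> roots D"
  define e where "e = \<gamma> h - \<gamma> k"
  \<comment> \<open>the composite of the two reflections, applied to \<open>\<delta>\<close>\<close>
  have step: "(\<lambda>x. \<delta> x + (\<delta> h - \<delta> k) * \<alpha> x) \<in> roots D" if "\<delta> \<in> roots D" for \<delta>
  proof -
    have 1: "(\<lambda>x. \<delta> x - \<delta> h * \<alpha> x) \<in> roots D" (is "?\<epsilon> \<in> _")
      using assms(2) that by (auto simp: is_coroot_def)
    have "(\<lambda>x. ?\<epsilon> x - ?\<epsilon> k * \<alpha> x) \<in> roots D"
      using assms(3) bspec[OF _ 1] unfolding is_coroot_def by blast
    moreover have "\<alpha> k = 2" using assms(3) by (simp add: is_coroot_def)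
    ultimately show ?thesis by (simp add: algebra_simps)
  qed
  have "(\<lambda>x. \<gamma> x + of_nat n * e * \<alpha> x) \<in> roots D" for n
  proof (induction n)
    case (Suc n)
    have "\<alpha> h = 2" "\<alpha> k = 2" using assms(2,3) by (auto simp: is_coroot_def)
    then show ?case using step[OF Suc.IH] by (simp add: algebra_simps e_def)
  qed (use \<gamma> in simp)
  then have "range (\<lambda>n::nat. (\<lambda>x. \<gamma> x + of_nat n * e * \<alpha> x)) \<subseteq> roots D" by auto
  then have "\<not> inj (\<lambda>n::nat. (\<lambda>x. \<gamma> x + of_nat n * e * \<alpha> x))"
    using finite_imageD[OF finite_subset[OF _ finite_roots]] infinite_UNIV_nat by blast
  then obtain m n :: nat where "m \<noteq> n"
    and "(\<lambda>x. \<gamma> x + of_nat m * e * \<alpha> x) = (\<lambda>x. \<gamma> x + of_nat n * e * \<alpha> x)"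
    by (auto simp: inj_def)
  from fun_cong[OF this(2), of h] \<open>m \<noteq> n\<close> assms(2) have "e = 0"
    by (simp add: is_coroot_def)
  then show "\<gamma> h = \<gamma> k" by (simp add: e_def)
qed

text \<open>
  The image of a coroot satisfies the conditions on a coroot, and coroots are unique.
\<close>

lemma reflection_coroot:
  assumes "\<alpha> \<in> roots D" "\<beta> \<in> roots D"
  shows "reflection D \<alpha> (coroot D (\<beta> \<circ> reflection D \<alpha>)) = coroot D \<beta>"
proof (rule coroot_unique[OF assms(2) _ coroot_is_coroot[OF assms(2)]])
  let ?s = "reflection D \<alpha>" and ?h = "coroot D (\<beta> \<circ> reflection D \<alpha>)"
  have r: "\<beta> \<circ> ?s \<in> roots D" using assms by (simp add: root_reflection)
  have "(\<lambda>x. \<gamma> x - \<gamma> (?s ?h) * \<beta> x) \<in> roots D" if "\<gamma> \<in> roots D" for \<gamma>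
  proof -
    have "(\<lambda>x. (\<gamma> \<circ> ?s) x - (\<gamma> \<circ> ?s) ?h * (\<beta> \<circ> ?s) x) \<in> roots D"
      using coroot_is_coroot[OF r] bspec[OF _ root_reflection[OF assms(1) that]]
      unfolding is_coroot_def by blast
    from root_reflection[OF assms(1) this] show ?thesis
      using assms by (simp add: comp_def reflection_reflection)
  qed
  moreover have "\<gamma> (?s ?h) \<in> \<int>" if "\<gamma> \<in> roots D" for \<gamma>
    using root_coroot_Ints[OF r root_reflection[OF assms(1) that]] by simp
  moreover have "\<beta> (?s ?h) = 2" using root_coroot[OF r] by simp
  ultimately show "is_coroot D \<beta> (?s ?h)" by (simp add: is_coroot_def)
qed

lemma reflection_conjugate:
  assumes "\<alpha> \<in> roots D" "\<beta> \<in> roots D"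
  shows "reflection D \<beta> \<circ> reflection D \<alpha> = reflection D \<alpha> \<circ> reflection D (\<beta> \<circ> reflection D \<alpha>)"
proof
  fix h
  let ?s = "reflection D \<alpha>" and ?k = "coroot D (\<beta> \<circ> reflection D \<alpha>)"
  have "?s (reflection D (\<beta> \<circ> ?s) h) = ?s (h + scale D (- \<beta> (?s h)) ?k)"
    by (simp add: reflection_def scale_minus_left)
  also have "\<dots> = ?s h - scale D (\<beta> (?s h)) (?s ?k)"
    unfolding reflection_add[OF assms(1)] reflection_scale[OF assms(1)]
    by (simp add: scale_minus_left)
  finally show "(reflection D \<beta> \<circ> ?s) h = (?s \<circ> reflection D (\<beta> \<circ> ?s)) h"
    by (simp add: reflection_coroot[OF assms] reflection_def[of D \<beta>] del: comp_apply)
      (simp add: reflection_def[of D \<beta>])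
qed

lemma reflection_neg:
  assumes "\<beta> \<in> roots D" shows "reflection D (\<lambda>h. - \<beta> h) = reflection D \<beta>"
proof -
  have "reflection D \<beta> \<circ> reflection D (\<lambda>h. - \<beta> h) = id"
    using reflection_conjugate[OF assms assms]
    by (simp only: reflection_involution[OF assms] root_reflection_self[OF assms])
  then have "reflection D \<beta> \<circ> (reflection D \<beta> \<circ> reflection D (\<lambda>h. - \<beta> h)) = reflection D \<beta>"
    by (simp only: comp_id)
  then show ?thesis by (simp only: reflection_comp_cancel(1)[OF assms])
qed

section \<open>Positivity of roots\<close>

text \<open>
  Gaussian elimination, one functional at a time: by independence, the new functional minus its
  combination of the old ones is nonzero, and a vector on which it does not vanish completes the
  dual basis.
\<close>

lemma dual_basis:
  assumes "finite F" "F \<subseteq> simple_indices"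
  shows "\<exists>h. \<forall>i\<in>F. \<forall>j\<in>F. simple D i (h j) = (if i = j then 1 else 0)"
  using assms
proof (induction F)
  case (insert k F)
  then obtain h where h: "\<And>i j. i \<in> F \<Longrightarrow> j \<in> F \<Longrightarrow> simple D i (h j) = (if i = j then 1 else 0)"
    by auto
  have dual: "simple D i \<in> dual D" if "i \<in> insert k F" for i
    using that insert.prems roots_dual simple_root by blast
  \<comment> \<open>the coefficients of the new functional minus its combination of the old ones\<close>
  define c where "c i = (if i = k then 1 else if i \<in> F then - simple D k (h i) else 0)" for i
  have k: "k \<in> simple_indices" using insert.prems by auto
  then obtain x where x: "(\<Sum>i\<in>simple_indices. c i * simple D i x) \<noteq> 0"
    using simple_independent[of c k] by (auto simp: c_def)
  have "(\<Sum>i\<in>simple_indices. c i * simple D i x) = (\<Sum>i\<in>insert k F. c i * simple D i x)"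
    using insert.prems by (intro sum.mono_neutral_right) (auto simp: c_def)
  also have "\<dots> = simple D k x - (\<Sum>i\<in>F. simple D k (h i) * simple D i x)"
    using insert.hyps by (auto simp: c_def sum_negf[symmetric] intro!: sum.cong)
  finally have x': "simple D k x - (\<Sum>i\<in>F. simple D k (h i) * simple D i x) \<noteq> 0" (is "?e \<noteq> 0")
    using x by simp
  \<comment> \<open>move \<open>x\<close> into the common kernel of the old functionals\<close>
  define y where "y = x - (\<Sum>i\<in>F. scale D (simple D i x) (h i))"
  have y: "simple D i y = simple D i x - (\<Sum>j\<in>F. simple D j x * simple D i (h j))"
    if "i \<in> insert k F" for i
    by (simp add: y_def dual_diff[OF dual[OF that]] dual_sum[OF dual[OF that]]
        dual_scale[OF dual[OF that]])
  have yF: "simple D i y = 0" if "i \<in> F" for i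
    using that insert.hyps(1) by (simp add: y h if_distrib sum.delta' cong: if_cong)
  have yk: "simple D k y = ?e" by (simp add: y mult.commute)
  define z where "z = scale D (1 / ?e) y"
  have zk: "simple D k z = 1" and zF: "\<And>i. i \<in> F \<Longrightarrow> simple D i z = 0"
    using x' dual by (auto simp: z_def dual_scale yk yF)
  define g where "g j = (if j = k then z else h j - scale D (simple D k (h j)) z)" for j
  have "simple D i (g j) = (if i = j then 1 else 0)" if "i \<in> insert k F" "j \<in> insert k F" for i j
    using that insert.hyps(2)
    by (auto simp: g_def dual_diff[OF dual] dual_scale[OF dual] zk zF h)
  then show ?case by blast
qed simp

definition fund_coweight :: "nat \<Rightarrow> 't"
  where "fund_coweight = (SOME h. \<forall>i\<in>simple_indices. \<forall>j\<in>simple_indices.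
    simple D i (h j) = (if i = j then 1 else 0))"

lemma simple_fund_coweight:
  "i \<in> simple_indices \<Longrightarrow> j \<in> simple_indices \<Longrightarrow> simple D i (fund_coweight j) = (if i = j then 1 else 0)"
  using someI_ex[OF dual_basis[of simple_indices]] unfolding fund_coweight_def by auto

text \<open>
  The point at which every simple root takes the value \<open>1\<close>. The value of a root there is its height,
  an integer; the real part makes the order of the reals available for signs.
\<close>

definition rho_check :: 't where "rho_check = (\<Sum>j\<in>simple_indices. fund_coweight j)"

definition ht :: "('t \<Rightarrow> complex) \<Rightarrow> real" where "ht \<beta> = Re (\<beta> rho_check)"

lemma simple_rho_check: "i \<in> simple_indices \<Longrightarrow> simple D i rho_check = 1"
  by (simp add: rho_check_def dual_sum[OF roots_dual[OF simple_root]] simple_fund_coweight)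

lemma ht_simple: "i \<in> simple_indices \<Longrightarrow> ht (simple D i) = 1"
  by (simp add: ht_def simple_rho_check)

lemma ht_neg: "ht (\<lambda>h. - \<beta> h) = - ht \<beta>"
  by (simp add: ht_def)

lemma nonneg_combination:
  assumes "\<beta> = (\<lambda>h. \<Sum>i\<in>simple_indices. of_nat (c i) * simple D i h)" "\<beta> \<in> roots D"
  shows "\<exists>n::nat. 0 < n \<and> \<beta> rho_check = of_nat n"
proof -
  have 1: "\<beta> rho_check = of_nat (\<Sum>i\<in>simple_indices. c i)"
    by (simp add: assms(1) simple_rho_check)
  have "\<not> (\<forall>i\<in>simple_indices. c i = 0)"
  proof
    assume "\<forall>i\<in>simple_indices. c i = 0"
    then have "\<beta> = (\<lambda>_. 0)" by (simp add: assms(1))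
    with assms(2) zero_not_root show False by simp
  qed
  then have "(\<Sum>i\<in>simple_indices. c i) \<noteq> 0" by simp
  with 1 show ?thesis by blast
qed

lemma pos_rootE:
  assumes "\<beta> \<in> pos_roots D"
  obtains c :: "nat \<Rightarrow> nat" where "\<beta> = (\<lambda>h. \<Sum>i\<in>simple_indices. of_nat (c i) * simple D i h)"
  using assms by (auto simp: pos_roots_def)

lemma pos_root: "\<beta> \<in> pos_roots D \<Longrightarrow> \<beta> \<in> roots D"
  by (simp add: pos_roots_def)

lemma finite_pos_roots: "finite (pos_roots D)"
  using finite_roots by (auto simp: pos_roots_def)

lemma pos_roots_iff: "\<beta> \<in> pos_roots D \<longleftrightarrow> \<beta> \<in> roots D \<and> 0 < ht \<beta>"
proof safe
  assume \<beta>: "\<beta> \<in> pos_roots D"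
  then show "\<beta> \<in> roots D" by (simp add: pos_roots_def)
  obtain c where "\<beta> = (\<lambda>h. \<Sum>i\<in>simple_indices. of_nat (c i) * simple D i h)"
    using \<beta> by (rule pos_rootE)
  from nonneg_combination[OF this \<open>\<beta> \<in> roots D\<close>] show "0 < ht \<beta>"
    by (auto simp: ht_def)
next
  assume \<beta>: "\<beta> \<in> roots D" "0 < ht \<beta>"
  show "\<beta> \<in> pos_roots D"
    using \<beta>(1)
  proof (cases rule: root_decomposition)
    case (1 c)
    then show ?thesis using \<beta> by (auto simp: pos_roots_def)
  next
    case (2 c)
    then have "ht \<beta> = - (\<Sum>i\<in>simple_indices. real (c i))"
      by (simp add: ht_def simple_rho_check)
    also have "\<dots> \<le> 0" by (simp add: sum_nonneg)
    finally show ?thesis using \<beta> by simp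
  qed
qed

lemma root_ht_cases:
  assumes "\<beta> \<in> roots D" shows "0 < ht \<beta> \<or> ht \<beta> < 0"
  using assms
proof (cases rule: root_decomposition)
  case (1 c)
  from nonneg_combination[OF 1 assms] show ?thesis by (auto simp: ht_def)
next
  case (2 c)
  have "(\<lambda>h. - \<beta> h) \<in> roots D" using root_neg assms by blast
  moreover have "(\<lambda>h. - \<beta> h) = (\<lambda>h. \<Sum>i\<in>simple_indices. of_nat (c i) * simple D i h)"
    by (simp add: 2)
  ultimately have "0 < ht (\<lambda>h. - \<beta> h)"
    using nonneg_combination[of "\<lambda>h. - \<beta> h" c] by (metis ht_def Re_complex_of_real of_nat_0_less_iff of_real_of_nat_eq)
  then show ?thesis by (simp add: ht_neg)
qed

lemma pos_root_rho_check: "\<beta> \<in> pos_roots D \<Longrightarrow> \<exists>n::nat. 0 < n \<and> \<beta> rho_check = of_nat n"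
proof -
  assume \<beta>: "\<beta> \<in> pos_roots D"
  then obtain c where "\<beta> = (\<lambda>h. \<Sum>i\<in>simple_indices. of_nat (c i) * simple D i h)"
    by (rule pos_rootE)
  from nonneg_combination[OF this pos_root[OF \<beta>]] show ?thesis .
qed

lemma neg_root_pos: "\<beta> \<in> roots D \<Longrightarrow> ht \<beta> < 0 \<Longrightarrow> (\<lambda>h. - \<beta> h) \<in> pos_roots D"
  by (simp add: pos_roots_iff root_neg ht_neg)

text \<open>
  A simple reflection changes one coefficient only, and a positive root other than the simple
  root has a positive coefficient elsewhere.
\<close>

lemma simple_refl_pos:
  assumes i: "i \<in> simple_indices" and \<beta>: "\<beta> \<in> pos_roots D" "\<beta> \<noteq> simple D i"
  shows "\<beta> \<circ> simple_refl i \<in> pos_roots D"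
proof (rule ccontr)
  let ?\<gamma> = "\<beta> \<circ> simple_refl i"
  assume neg: "?\<gamma> \<notin> pos_roots D"
  have \<gamma>: "?\<gamma> \<in> roots D" by (rule root_reflection) (use i \<beta> simple_root pos_root in auto)
  obtain c where c: "\<beta> = (\<lambda>h. \<Sum>i\<in>simple_indices. of_nat (c i) * simple D i h)"
    using \<beta>(1) by (rule pos_rootE)
  obtain d where d: "?\<gamma> = (\<lambda>h. - (\<Sum>i\<in>simple_indices. of_nat (d i) * simple D i h))"
    using \<gamma>
  proof (cases rule: root_decomposition)
    case (1 c)
    with neg \<gamma> show ?thesis by (auto simp: pos_roots_def)
  qed
  have "c j = 0" if j: "j \<in> simple_indices" "j \<noteq> i" for j
  proof -
    have "?\<gamma> (fund_coweight j) = \<beta> (fund_coweight j)"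
      using i j \<beta>(1)
      by (simp add: reflection_functional[OF roots_dual[OF pos_root]] simple_fund_coweight)
    also have "\<dots> = of_nat (c j)"
      using j by (simp add: c simple_fund_coweight if_distrib sum.delta cong: if_cong)
    finally have "- of_nat (d j) = (of_nat (c j) :: complex)"
      using j unfolding d by (simp add: simple_fund_coweight if_distrib sum.delta cong: if_cong)
    then have "of_nat (c j + d j) = (0::complex)" by (metis add.left_inverse of_nat_add add.commute)
    then show ?thesis by (simp only: of_nat_eq_0_iff)
  qed
  then have "(\<Sum>j\<in>simple_indices. of_nat (c j) * simple D j h) = (\<Sum>j\<in>{i}. of_nat (c j) * simple D j h)" for h
    using i by (intro sum.mono_neutral_right) auto
  then have eq: "\<beta> = (\<lambda>h. of_nat (c i) * simple D i h)"
    unfolding c by simp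
  then have "of_nat (c i) = (1::complex) \<or> of_nat (c i) = (-1::complex)"
    using roots_reduced[of "simple D i" "of_nat (c i)"] pos_root[OF \<beta>(1)] simple_root[OF i] by simp
  moreover have "of_nat (c i) \<noteq> (-1::complex)"
    by (simp add: complex_eq_iff)
  ultimately show False using eq \<beta>(2) by auto
qed

section \<open>The Weyl group as a set of words\<close>

text \<open>
  The sum over all roots \<open>\<gamma>\<close> of \<open>\<gamma> x * \<gamma> y\<close> is an invariant symmetric form on the vector space, and
  it turns the coroot of \<open>\<beta>\<close> into a positive multiple of \<open>\<beta>\<close>.
\<close>

lemma coroot_form:
  assumes "\<beta> \<in> roots D"
  shows "\<beta> x * (\<Sum>\<gamma>\<in>roots D. \<gamma> (coroot D \<beta>) * \<gamma> (coroot D \<beta>)) =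
    2 * (\<Sum>\<gamma>\<in>roots D. \<gamma> (coroot D \<beta>) * \<gamma> x)"
proof -
  let ?h = "coroot D \<beta>" and ?s = "reflection D \<beta>"
  have "(\<Sum>\<gamma>\<in>roots D. \<gamma> ?h * \<gamma> x) = (\<Sum>\<gamma>\<in>roots D. (\<gamma> \<circ> ?s) ?h * (\<gamma> \<circ> ?s) x)"
    by (rule sum.reindex_bij_witness[of _ "\<lambda>\<gamma>. \<gamma> \<circ> ?s" "\<lambda>\<gamma>. \<gamma> \<circ> ?s"])
      (use assms in \<open>auto simp: root_reflection reflection_comp_cancel(2) reflection_reflection\<close>)
  also have "\<dots> = (\<Sum>\<gamma>\<in>roots D. \<beta> x * (\<gamma> ?h * \<gamma> ?h) - \<gamma> ?h * \<gamma> x)"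
    using assms root_coroot[OF assms]
    by (intro sum.cong) (auto simp: reflection_functional[OF roots_dual] algebra_simps)
  also have "\<dots> = \<beta> x * (\<Sum>\<gamma>\<in>roots D. \<gamma> ?h * \<gamma> ?h) - (\<Sum>\<gamma>\<in>roots D. \<gamma> ?h * \<gamma> x)"
    by (simp add: sum_subtractf sum_distrib_left)
  finally show ?thesis by simp
qed

lemma coroot_form_pos:
  assumes "\<beta> \<in> roots D"
  shows "\<exists>r>0. (\<Sum>\<gamma>\<in>roots D. \<gamma> (coroot D \<beta>) * \<gamma> (coroot D \<beta>)) = of_real r"
proof (intro exI conjI)
  let ?h = "coroot D \<beta>" and ?r = "\<Sum>\<gamma>\<in>roots D. (Re (\<gamma> (coroot D \<beta>)))\<^sup>2"
  have "\<gamma> ?h * \<gamma> ?h = of_real ((Re (\<gamma> ?h))\<^sup>2)" if "\<gamma> \<in> roots D" for \<gamma>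
    using root_coroot_Ints[OF assms that] by (auto elim!: Ints_cases simp: power2_eq_square)
  then show "(\<Sum>\<gamma>\<in>roots D. \<gamma> ?h * \<gamma> ?h) = of_real ?r" by simp
  show "0 < ?r"
    by (rule sum_pos2[OF finite_roots assms]) (simp_all add: root_coroot[OF assms])
qed

text \<open>
  Up to positive factors, both numbers are the value of the invariant form at the two coroots.
\<close>

lemma coroot_sign_symmetric:
  assumes "\<alpha> \<in> roots D" "\<beta> \<in> roots D" "0 < Re (\<alpha> (coroot D \<beta>))"
  shows "0 < Re (\<beta> (coroot D \<alpha>))"
proof -
  obtain r where r: "r > 0" "(\<Sum>\<gamma>\<in>roots D. \<gamma> (coroot D \<alpha>) * \<gamma> (coroot D \<alpha>)) = of_real r"
    using coroot_form_pos[OF assms(1)] by blast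
  obtain q where q: "q > 0" "(\<Sum>\<gamma>\<in>roots D. \<gamma> (coroot D \<beta>) * \<gamma> (coroot D \<beta>)) = of_real q"
    using coroot_form_pos[OF assms(2)] by blast
  have "\<beta> (coroot D \<alpha>) * of_real q = \<alpha> (coroot D \<beta>) * of_real r"
    using coroot_form[OF assms(2), of "coroot D \<alpha>"] coroot_form[OF assms(1), of "coroot D \<beta>"] r q
    by (simp add: mult.commute)
  from arg_cong[OF this, of Re] have "Re (\<beta> (coroot D \<alpha>)) * q = Re (\<alpha> (coroot D \<beta>)) * r"
    by simp
  moreover have "0 < Re (\<alpha> (coroot D \<beta>)) * r" using assms(3) r by simp
  ultimately show ?thesis using q(1) by (metis zero_less_mult_pos2)
qed

lemma word_Nil: "word D [] = id"
  and word_Cons: "word D (j # js) = simple_refl j \<circ> word D js"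
  by (simp_all add: word_def)

lemma word_append: "word D (xs @ ys) = word D xs \<circ> word D ys"
  by (induction xs) (auto simp: word_Nil word_Cons comp_assoc)

lemma word_snoc: "word D (xs @ [i]) = word D xs \<circ> simple_refl i"
  by (simp add: word_append word_Cons word_Nil)

lemma word_rev_cancel: "set js \<subseteq> simple_indices \<Longrightarrow> word D (rev js) \<circ> word D js = id"
proof (induction js)
  case (Cons j js)
  have "word D (rev (j # js)) \<circ> word D (j # js)
      = word D (rev js) \<circ> (simple_refl j \<circ> (simple_refl j \<circ> word D js))"
    by (simp add: word_append word_Cons word_Nil comp_assoc)
  also have "\<dots> = id"
  proof -
    have "j \<in> simple_indices" "set js \<subseteq> simple_indices" using Cons.prems by auto
    then show ?thesis
      by (simp only: reflection_comp_cancel(1)[OF simple_root] Cons.IH)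
  qed
  finally show ?case .
qed (simp add: word_Nil)

lemma word_bij: "set js \<subseteq> simple_indices \<Longrightarrow> bij (word D js)"
  using word_rev_cancel[of js] word_rev_cancel[of "rev js"]
  by (intro o_bij[of "word D (rev js)"]) simp_all

lemma root_word: "set js \<subseteq> simple_indices \<Longrightarrow> \<beta> \<in> roots D \<Longrightarrow> \<beta> \<circ> word D js \<in> roots D"
  by (induction js arbitrary: \<beta>)
    (auto simp: word_Nil word_Cons comp_assoc[symmetric] root_reflection simple_root)

text \<open>
  A positive root \<open>\<beta>\<close> is a combination of simple roots and takes the value \<open>2\<close> at its coroot, so some
  simple root is positive there. By symmetry \<open>\<beta>\<close> is positive at the corresponding simple coroot, so
  that simple reflection lowers the height of \<open>\<beta>\<close>. Hence \<open>\<beta>\<close> is conjugate to a simple root, and so is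
  its reflection.
\<close>

lemma reflection_word:
  assumes "\<beta> \<in> pos_roots D"
  shows "\<exists>js. set js \<subseteq> simple_indices \<and> reflection D \<beta> = word D js"
proof -
  obtain n :: nat where "\<beta> rho_check = of_nat n" using pos_root_rho_check[OF assms] by blast
  then show ?thesis
    using assms
  proof (induction n arbitrary: \<beta> rule: less_induct)
    case (less n)
    note \<beta> = pos_root[OF less.prems(2)]
    obtain c where c: "\<beta> = (\<lambda>h. \<Sum>i\<in>simple_indices. of_nat (c i) * simple D i h)"
      using less.prems(2) by (rule pos_rootE)
    have "2 = Re (\<beta> (coroot D \<beta>))" by (simp add: root_coroot[OF \<beta>])
    also have "\<dots> = Re (\<Sum>i\<in>simple_indices. of_nat (c i) * simple D i (coroot D \<beta>))"
      by (rule arg_cong[OF fun_cong[OF c]])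
    also have "\<dots> = (\<Sum>i\<in>simple_indices. real (c i) * Re (simple D i (coroot D \<beta>)))"
      by simp
    finally have "\<not> (\<Sum>i\<in>simple_indices. real (c i) * Re (simple D i (coroot D \<beta>))) \<le> 0" by simp
    then obtain i where i: "i \<in> simple_indices" "\<not> real (c i) * Re (simple D i (coroot D \<beta>)) \<le> 0"
      using sum_nonpos by meson
    then have "0 < Re (simple D i (coroot D \<beta>))"
      by (simp add: mult_le_0_iff not_le)
    from coroot_sign_symmetric[OF simple_root[OF i(1)] \<beta> this]
    have pos: "0 < Re (\<beta> (coroot D (simple D i)))" .
    show ?case
    proof (cases "\<beta> = simple D i")
      case True
      then show ?thesis using i(1) by (intro exI[of _ "[i]"]) (simp add: word_Cons word_Nil)
    next
      case False
      let ?\<gamma> = "\<beta> \<circ> simple_refl i"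
      have \<gamma>: "?\<gamma> \<in> pos_roots D" by (rule simple_refl_pos[OF i(1) less.prems(2) False])
      then obtain m :: nat where m: "?\<gamma> rho_check = of_nat m" using pos_root_rho_check by blast
      have "?\<gamma> rho_check = of_nat n - \<beta> (coroot D (simple D i))"
        using i(1) by (simp add: reflection_functional[OF roots_dual[OF \<beta>]] simple_rho_check less.prems(1))
      with m have "Re (of_nat m) = Re (of_nat n - \<beta> (coroot D (simple D i)))" by simp
      then have "m < n" using pos by simp
      from less.IH[OF this m \<gamma>] obtain js where js: "set js \<subseteq> simple_indices"
        "reflection D ?\<gamma> = word D js" by blast
      have "reflection D \<beta> = simple_refl i \<circ> reflection D ?\<gamma> \<circ> simple_refl i"
        unfolding reflection_conjugate[OF simple_root[OF i(1)] \<beta>, symmetric]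
        by (simp only: reflection_comp_cancel(2)[OF simple_root[OF i(1)]])
      also have "\<dots> = word D (i # js @ [i])"
        by (simp add: js word_Cons word_append word_Nil comp_assoc)
      finally show ?thesis using js i(1) by (intro exI[of _ "i # js @ [i]"]) simp
    qed
  qed
qed

lemma reflection_word_root:
  assumes "\<beta> \<in> roots D"
  shows "\<exists>js. set js \<subseteq> simple_indices \<and> reflection D \<beta> = word D js"
proof (cases "0 < ht \<beta>")
  case True
  then show ?thesis using assms by (intro reflection_word) (simp add: pos_roots_iff)
next
  case False
  then have "(\<lambda>h. - \<beta> h) \<in> pos_roots D"
    using root_ht_cases[OF assms] neg_root_pos[OF assms] by blast
  from reflection_word[OF this] show ?thesis by (simp only: reflection_neg[OF assms])
qed

text \<open>
  The generators are involutions and every one of them is a word, so words are closed under the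
  group operations.
\<close>

lemma generate_reflections_word:
  assumes "K \<subseteq> simple_indices" "R \<subseteq> roots D" "\<And>i. i \<in> K \<Longrightarrow> simple D i \<in> R"
    and R: "\<And>\<beta>. \<beta> \<in> R \<Longrightarrow> \<exists>js. set js \<subseteq> K \<and> reflection D \<beta> = word D js"
  shows "generate (BijGroup UNIV) (reflection D ` R) = {word D js | js. set js \<subseteq> K}"
proof (intro equalityI subsetI)
  let ?B = "BijGroup (UNIV :: 't set)"
  have car: "f \<in> carrier ?B \<longleftrightarrow> bij f" for f :: "'t \<Rightarrow> 't"
    by (simp add: BijGroup_def Bij_def extensional_def)
  have mult: "f \<otimes>\<^bsub>?B\<^esub> g = f \<circ> g" if "bij f" "bij g" for f g :: "'t \<Rightarrow> 't"
    using that by (auto simp: BijGroup_def Bij_def extensional_def compose_def fun_eq_iff)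
  have one: "\<one>\<^bsub>?B\<^esub> = id" by (auto simp: BijGroup_def)
  interpret B: group ?B by (rule group_BijGroup)
  {
    fix w assume "w \<in> generate ?B (reflection D ` R)"
    then show "w \<in> {word D js | js. set js \<subseteq> K}"
    proof induction
      case one
      show ?case unfolding \<open>\<one>\<^bsub>?B\<^esub> = id\<close> using word_Nil by (auto intro!: exI[of _ "[]"])
    next
      case (incl h)
      then show ?case using R by blast
    next
      case (inv h)
      then obtain \<beta> where \<beta>: "\<beta> \<in> R" "h = reflection D \<beta>" by blast
      then have root: "\<beta> \<in> roots D" using assms(2) by auto
      have "inv\<^bsub>?B\<^esub> h = h"
        by (rule B.inv_equality)
          (simp_all add: car mult one \<beta> bij_reflection root reflection_involution)
      then show ?case using R \<beta> by auto
    next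
      case (eng h1 h2)
      then obtain xs ys where *: "h1 = word D xs" "h2 = word D ys" "set xs \<subseteq> K" "set ys \<subseteq> K"
        by blast
      then have "h1 \<otimes>\<^bsub>?B\<^esub> h2 = word D (xs @ ys)"
        using assms(1) by (simp add: mult word_bij word_append)
      then show ?case using * by (auto intro!: exI[of _ "xs @ ys"])
    qed
  }
  fix w assume "w \<in> {word D js | js. set js \<subseteq> K}"
  then obtain js where "set js \<subseteq> K" "w = word D js" by blast
  then show "w \<in> generate ?B (reflection D ` R)"
  proof (induction js arbitrary: w)
    case Nil
    then show ?case using generate.one[of ?B "reflection D ` R"] unfolding one by (simp only: word_Nil)
  next
    case (Cons j js)
    have "simple_refl j \<in> generate ?B (reflection D ` R)"
      using Cons.prems assms(3) by (intro generate.incl) auto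
    moreover have "word D js \<in> generate ?B (reflection D ` R)"
      using Cons.prems by (intro Cons.IH) auto
    moreover have "j \<in> simple_indices" "set js \<subseteq> simple_indices"
      using Cons.prems(1) assms(1) by auto
    ultimately have "simple_refl j \<circ> word D js \<in> generate ?B (reflection D ` R)"
      using generate.eng[of "simple_refl j" ?B "reflection D ` R" "word D js"]
      by (simp add: mult bij_reflection simple_root word_bij del: comp_apply)
    then show ?case by (simp only: Cons.prems(2) word_Cons)
  qed
qed

lemma Weyl_iff: "w \<in> Weyl D \<longleftrightarrow> (\<exists>js. set js \<subseteq> simple_indices \<and> w = word D js)"
proof -
  have "Weyl D = {word D js | js. set js \<subseteq> simple_indices}"
    unfolding Weyl_def
    by (rule generate_reflections_word)
      (simp_all only: simple_root reflection_word_root subset_refl)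
  then show ?thesis by blast
qed

lemma parabolic_Weyl_iff:
  assumes "J \<subseteq> simple_indices"
  shows "w \<in> parabolic_Weyl D J \<longleftrightarrow> (\<exists>js. set js \<subseteq> J \<and> w = word D js)"
proof -
  have "\<exists>js. set js \<subseteq> J \<and> reflection D \<beta> = word D js" if "\<beta> \<in> simple D ` J" for \<beta>
  proof -
    from that obtain j where "j \<in> J" "\<beta> = simple D j" by blast
    then show ?thesis by (intro exI[of _ "[j]"]) (simp add: word_Cons word_Nil)
  qed
  moreover have "simple D ` J \<subseteq> roots D" using assms simple_root by blast
  ultimately have "generate (BijGroup UNIV) (reflection D ` simple D ` J) = {word D js | js. set js \<subseteq> J}"
    by (intro generate_reflections_word[OF assms]) auto
  then show ?thesis unfolding parabolic_Weyl_def image_image by blast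
qed

section \<open>Length, exchange and inversions\<close>

lemma WeylE:
  assumes "w \<in> Weyl D"
  obtains js where "set js \<subseteq> simple_indices" "w = word D js"
  using assms by (auto simp: Weyl_iff)

lemma word_Weyl: "set js \<subseteq> simple_indices \<Longrightarrow> word D js \<in> Weyl D"
  by (auto simp: Weyl_iff)

lemma Weyl_id: "id \<in> Weyl D"
  using word_Weyl[of "[]"] by (simp add: word_Nil)

lemma Weyl_reflection: "\<beta> \<in> roots D \<Longrightarrow> reflection D \<beta> \<in> Weyl D"
  using reflection_word_root[of \<beta>] by (auto simp: Weyl_iff)

lemma Weyl_comp: "u \<in> Weyl D \<Longrightarrow> v \<in> Weyl D \<Longrightarrow> u \<circ> v \<in> Weyl D"
proof (elim WeylE)
  fix xs ys assume "set xs \<subseteq> simple_indices" "u = word D xs" "set ys \<subseteq> simple_indices" "v = word D ys"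
  then show ?thesis using word_Weyl[of "xs @ ys"] by (simp add: word_append)
qed

lemma Weyl_reflection_comp: "\<beta> \<in> roots D \<Longrightarrow> w \<in> Weyl D \<Longrightarrow> reflection D \<beta> \<circ> w \<in> Weyl D"
  and Weyl_comp_simple: "i \<in> simple_indices \<Longrightarrow> w \<in> Weyl D \<Longrightarrow> w \<circ> simple_refl i \<in> Weyl D"
  by (simp_all add: Weyl_comp Weyl_reflection simple_root)

lemma Weyl_bij: "w \<in> Weyl D \<Longrightarrow> bij w"
  by (elim WeylE) (simp add: word_bij)

lemma root_Weyl: "w \<in> Weyl D \<Longrightarrow> \<beta> \<in> roots D \<Longrightarrow> \<beta> \<circ> w \<in> roots D"
  by (elim WeylE) (simp add: root_word)

lemma Weyl_inv: "w \<in> Weyl D \<Longrightarrow> inv_into UNIV w \<in> Weyl D"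
proof (elim WeylE)
  fix js assume js: "set js \<subseteq> simple_indices" "w = word D js"
  then have "inv_into UNIV w = word D (rev js)"
    using word_rev_cancel[of "rev js"] word_rev_cancel[of js]
    by (intro inv_unique_comp) simp_all
  with js show ?thesis using word_Weyl[of "rev js"] by simp
qed

text \<open>
  The conjugation formula for the reflection in \<open>w\<^sup>-\<^sup>1(\<beta>)\<close>, in a form that avoids inverses.
\<close>

lemma reflection_Weyl:
  assumes "w \<in> Weyl D" "\<beta> \<in> roots D"
  shows "reflection D \<beta> \<circ> w = w \<circ> reflection D (\<beta> \<circ> w)"
proof -
  obtain js where "set js \<subseteq> simple_indices" "w = word D js" using assms(1) by (rule WeylE)
  moreover have "set js \<subseteq> simple_indices \<Longrightarrow>
    reflection D \<beta> \<circ> word D js = word D js \<circ> reflection D (\<beta> \<circ> word D js)"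
    using assms(2)
  proof (induction js arbitrary: \<beta>)
    case (Cons j js)
    then have j: "simple D j \<in> roots D" and js: "set js \<subseteq> simple_indices"
      by (simp_all add: simple_root)
    have "reflection D \<beta> \<circ> word D (j # js)
        = simple_refl j \<circ> (reflection D (\<beta> \<circ> simple_refl j) \<circ> word D js)"
      using reflection_conjugate[OF j Cons.prems(2)] by (simp only: word_Cons comp_assoc[symmetric])
    also have "\<dots> = simple_refl j \<circ> (word D js \<circ> reflection D (\<beta> \<circ> simple_refl j \<circ> word D js))"
      using Cons.IH[OF js root_reflection[OF j Cons.prems(2)]] by (simp only:)
    finally show ?case by (simp only: word_Cons comp_assoc)
  qed (simp add: word_Nil)
  ultimately show ?thesis by simp
qed

text \<open>The root \<open>w(\<alpha>\<^sub>i)\<close>.\<close>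

definition simple_image :: "('t \<Rightarrow> 't) \<Rightarrow> nat \<Rightarrow> 't \<Rightarrow> complex"
  where "simple_image w i = simple D i \<circ> inv_into UNIV w"

lemma simple_image_root: "w \<in> Weyl D \<Longrightarrow> i \<in> simple_indices \<Longrightarrow> simple_image w i \<in> roots D"
  by (simp add: simple_image_def root_Weyl Weyl_inv simple_root)

lemma simple_image_comp: "w \<in> Weyl D \<Longrightarrow> simple_image w i \<circ> w = simple D i"
  using Weyl_bij[of w] by (simp add: simple_image_def comp_assoc bij_is_inj)

lemma simple_image_eqI: "w \<in> Weyl D \<Longrightarrow> \<beta> \<circ> w = simple D i \<Longrightarrow> simple_image w i = \<beta>"
proof -
  assume w: "w \<in> Weyl D" and eq: "\<beta> \<circ> w = simple D i"
  have "w \<circ> inv_into UNIV w = id" using Weyl_bij[OF w] by (simp add: bij_is_surj surj_iff[symmetric])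
  then show ?thesis by (simp add: simple_image_def eq[symmetric] comp_assoc)
qed

lemma reflection_simple_image:
  "w \<in> Weyl D \<Longrightarrow> i \<in> simple_indices \<Longrightarrow> reflection D (simple_image w i) \<circ> w = w \<circ> simple_refl i"
  by (simp add: reflection_Weyl simple_image_root simple_image_comp)

lemma simple_image_reflection:
  "w \<in> Weyl D \<Longrightarrow> \<beta> \<in> roots D \<Longrightarrow>
    simple_image (reflection D \<beta> \<circ> w) i = simple_image w i \<circ> reflection D \<beta>"
  by (rule simple_image_eqI)
    (simp_all add: Weyl_reflection_comp comp_assoc reflection_comp_cancel(1) simple_image_comp)

lemma simple_image_comp_simple:
  "w \<in> Weyl D \<Longrightarrow> i \<in> simple_indices \<Longrightarrow> simple_image (w \<circ> simple_refl i) i = (\<lambda>h. - simple_image w i h)"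
  using simple_image_reflection[of w "simple_image w i" i] reflection_simple_image[of w i]
  by (simp add: simple_image_root root_reflection_self)

text \<open>The condition amounts to \<open>w s\<^sub>i\<close> being longer than \<open>w\<close>; see \<open>len_ascent\<close> and \<open>len_descent\<close>.\<close>

definition ascent :: "('t \<Rightarrow> 't) \<Rightarrow> nat \<Rightarrow> bool"
  where "ascent w i \<longleftrightarrow> 0 < ht (simple_image w i)"

lemma ascent_iff:
  "w \<in> Weyl D \<Longrightarrow> i \<in> simple_indices \<Longrightarrow> ascent w i \<longleftrightarrow> simple_image w i \<in> pos_roots D"
  by (simp add: ascent_def pos_roots_iff simple_image_root)

lemma ascent_comp_simple:
  "w \<in> Weyl D \<Longrightarrow> i \<in> simple_indices \<Longrightarrow> ascent (w \<circ> simple_refl i) i \<longleftrightarrow> \<not> ascent w i"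
  using root_ht_cases[OF simple_image_root[of w i]]
  by (auto simp: ascent_def simple_image_comp_simple ht_neg)

lemma comp_simple_cancel: "i \<in> simple_indices \<Longrightarrow> w \<circ> simple_refl i \<circ> simple_refl i = w"
  by (rule reflection_comp_cancel(2)[OF simple_root])

text \<open>
  Strong exchange: along the word, the positive root \<open>\<beta>\<close> turns negative at some letter, where it
  has become the simple root of this letter; reflecting in \<open>\<beta>\<close> deletes the letter.
\<close>

lemma strong_exchange:
  assumes "set js \<subseteq> simple_indices" "\<beta> \<in> pos_roots D" "ht (\<beta> \<circ> word D js) < 0"
  shows "\<exists>ks. set ks \<subseteq> set js \<and> length ks < length js \<and> reflection D \<beta> \<circ> word D js = word D ks"
  using assms
proof (induction js arbitrary: \<beta>)
  case Nil
  then show ?case by (simp add: word_Nil pos_roots_iff)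
next
  case (Cons j js)
  then have j: "j \<in> simple_indices" and root: "simple D j \<in> roots D" by (simp_all add: simple_root)
  show ?case
  proof (cases "\<beta> = simple D j")
    case True
    then show ?thesis
      by (intro exI[of _ js]) (auto simp: word_Cons reflection_comp_cancel(1)[OF root] simp del: comp_apply)
  next
    case False
    let ?\<gamma> = "\<beta> \<circ> simple_refl j"
    have "?\<gamma> \<in> pos_roots D" by (rule simple_refl_pos[OF j Cons.prems(2) False])
    moreover have "ht (?\<gamma> \<circ> word D js) < 0" using Cons.prems(3) by (simp only: word_Cons comp_assoc)
    ultimately obtain ks where "set ks \<subseteq> set js" "length ks < length js"
      "reflection D ?\<gamma> \<circ> word D js = word D ks" using Cons.IH[of ?\<gamma>] Cons.prems(1) by (auto simp del: comp_apply)
    moreover have "reflection D \<beta> \<circ> word D (j # js) = simple_refl j \<circ> (reflection D ?\<gamma> \<circ> word D js)"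
      using reflection_conjugate[OF root pos_root[OF Cons.prems(2)]]
      by (simp add: word_Cons comp_assoc[symmetric])
    ultimately show ?thesis by (intro exI[of _ "j # ks"]) (auto simp: word_Cons simp del: comp_apply)
  qed
qed

lemma len_le: "set js \<subseteq> simple_indices \<Longrightarrow> len D (word D js) \<le> length js"
  unfolding len_def by (rule Least_le) blast

lemma reduced_word:
  assumes "w \<in> Weyl D"
  obtains js where "set js \<subseteq> simple_indices" "w = word D js" "length js = len D w"
proof -
  have "\<exists>k js. length js = k \<and> set js \<subseteq> simple_indices \<and> w = word D js"
    using assms Weyl_iff by blast
  from LeastI_ex[OF this] that show thesis unfolding len_def by blast
qed

lemma len_reflection_less:
  assumes "w \<in> Weyl D" "\<beta> \<in> pos_roots D" "ht (\<beta> \<circ> w) < 0"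
  shows "len D (reflection D \<beta> \<circ> w) < len D w"
proof -
  obtain js where js: "set js \<subseteq> simple_indices" "w = word D js" "length js = len D w"
    using reduced_word[OF assms(1)] .
  with strong_exchange[OF js(1) assms(2)] assms(3) obtain ks where
    "set ks \<subseteq> set js" "length ks < length js" "reflection D \<beta> \<circ> w = word D ks" by auto
  moreover have "len D (word D ks) \<le> length ks" using calculation js by (intro len_le) auto
  ultimately show ?thesis using js by auto
qed

lemma len_reflection_greater:
  assumes "w \<in> Weyl D" "\<beta> \<in> pos_roots D" "0 < ht (\<beta> \<circ> w)"
  shows "len D w < len D (reflection D \<beta> \<circ> w)"
proof -
  have "\<beta> \<circ> (reflection D \<beta> \<circ> w) = (\<lambda>h. - (\<beta> \<circ> w) h)"
    using root_reflection_self[OF pos_root[OF assms(2)]] by (simp add: fun_eq_iff)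
  then have "ht (\<beta> \<circ> (reflection D \<beta> \<circ> w)) < 0" using assms(3) ht_neg[of "\<beta> \<circ> w"] by simp
  from len_reflection_less[OF Weyl_reflection_comp[OF pos_root[OF assms(2)] assms(1)] assms(2) this]
  show ?thesis by (simp add: reflection_comp_cancel(1) pos_root assms(2))
qed

lemma len_reflection_iff:
  assumes "w \<in> Weyl D" "\<beta> \<in> pos_roots D"
  shows "len D w < len D (reflection D \<beta> \<circ> w) \<longleftrightarrow> 0 < ht (\<beta> \<circ> w)"
  using len_reflection_less[OF assms] len_reflection_greater[OF assms]
    root_ht_cases[OF root_Weyl[OF assms(1) pos_root[OF assms(2)]]] by auto

lemma len_comp_simple_le:
  assumes "w \<in> Weyl D" "i \<in> simple_indices"
  shows "len D (w \<circ> simple_refl i) \<le> len D w + 1"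
proof -
  obtain js where js: "set js \<subseteq> simple_indices" "w = word D js" "length js = len D w"
    using reduced_word[OF assms(1)] .
  then show ?thesis using len_le[of "js @ [i]"] assms(2) by (simp add: word_snoc)
qed

lemma len_ascent:
  assumes "w \<in> Weyl D" "i \<in> simple_indices" "ascent w i"
  shows "len D (w \<circ> simple_refl i) = len D w + 1"
  using len_comp_simple_le[OF assms(1,2)] len_reflection_greater[of w "simple_image w i"] assms
  by (simp add: ascent_iff reflection_simple_image simple_image_comp ht_simple)

lemma len_descent:
  assumes "w \<in> Weyl D" "i \<in> simple_indices" "\<not> ascent w i"
  shows "len D w = len D (w \<circ> simple_refl i) + 1"
  using len_ascent[of "w \<circ> simple_refl i" i] assms
  by (simp add: Weyl_comp_simple ascent_comp_simple comp_simple_cancel)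

lemma len_id: "len D id = 0"
  using len_le[of "[]"] by (simp add: word_Nil)

lemma descent_exists:
  assumes "w \<in> Weyl D" "w \<noteq> id"
  obtains i where "i \<in> simple_indices" "\<not> ascent w i"
proof -
  obtain js where js: "set js \<subseteq> simple_indices" "w = word D js" "length js = len D w"
    using reduced_word[OF assms(1)] .
  with assms(2) have "js \<noteq> []" by (auto simp: word_Nil)
  then obtain ks i where ks: "js = ks @ [i]" by (metis rev_exhaust)
  with js ks have i: "i \<in> simple_indices" and v: "word D ks \<in> Weyl D" by (auto intro!: word_Weyl)
  have "w \<circ> simple_refl i = word D ks" using js ks i by (simp add: word_snoc comp_simple_cancel)
  moreover have "len D (word D ks) < len D w" using len_le[of ks] js ks by simp
  ultimately show thesis using that[OF i] len_ascent[OF assms(1) i] by fastforce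
qed

lemma Weyl_induct [consumes 1, case_names id ascent]:
  assumes "w \<in> Weyl D" "P id"
    and "\<And>w i. w \<in> Weyl D \<Longrightarrow> i \<in> simple_indices \<Longrightarrow> ascent w i \<Longrightarrow> P w \<Longrightarrow> P (w \<circ> simple_refl i)"
  shows "P w"
  using assms(1)
proof (induction "len D w" arbitrary: w rule: less_induct)
  case less
  show ?case
  proof (cases "w = id")
    case False
    with less.prems obtain i where i: "i \<in> simple_indices" "\<not> ascent w i" by (rule descent_exists)
    let ?v = "w \<circ> simple_refl i"
    have v: "?v \<in> Weyl D" "ascent ?v i"
      using less.prems i by (simp_all add: Weyl_comp_simple ascent_comp_simple)
    have "P ?v" using less.hyps[OF _ v(1)] len_descent[OF less.prems i] by simp
    from assms(3)[OF v(1) i(1) v(2) this] show ?thesis using i by (simp add: comp_simple_cancel)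
  qed (use assms(2) in simp)
qed

definition inversions :: "('t \<Rightarrow> 't) \<Rightarrow> ('t \<Rightarrow> complex) set"
  where "inversions w = {\<beta> \<in> pos_roots D. ht (\<beta> \<circ> w) < 0}"

lemma inversions_pos: "inversions w \<subseteq> pos_roots D"
  by (auto simp: inversions_def)

lemma finite_inversions: "finite (inversions w)"
  using finite_subset[OF inversions_pos finite_pos_roots] .

text \<open>
  Among the positive roots, \<open>s\<^sub>i\<close> changes the sign of \<open>\<alpha>\<^sub>i\<close> only, so \<open>w(\<alpha>\<^sub>i)\<close> is the only root that
  enters or leaves the set of inversions.
\<close>

lemma inversions_ascent:
  assumes w: "w \<in> Weyl D" and i: "i \<in> simple_indices" "ascent w i"
  shows "inversions (w \<circ> simple_refl i) = insert (simple_image w i) (inversions w)"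
    and "simple_image w i \<notin> inversions w"
proof -
  let ?\<alpha> = "simple_image w i" and ?s = "simple_refl i"
  have pos: "?\<alpha> \<in> pos_roots D" using assms by (simp add: ascent_iff)
  show "?\<alpha> \<notin> inversions w" using i by (simp add: inversions_def simple_image_comp[OF w] ht_simple)
  have eq: "ht (\<beta> \<circ> (w \<circ> ?s)) < 0 \<longleftrightarrow> \<beta> = ?\<alpha> \<or> ht (\<beta> \<circ> w) < 0" if \<beta>: "\<beta> \<in> pos_roots D" for \<beta>
  proof -
    have root: "\<beta> \<circ> w \<in> roots D" using root_Weyl[OF w pos_root[OF \<beta>]] .
    have inj: "\<beta> = ?\<alpha>" if "\<beta> \<circ> w = simple D i" using simple_image_eqI[OF w that] by simp
    consider "\<beta> \<circ> w = simple D i" | "\<beta> \<circ> w \<in> pos_roots D" "\<beta> \<circ> w \<noteq> simple D i"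
      | "ht (\<beta> \<circ> w) < 0" using root_ht_cases[OF root] root by (auto simp: pos_roots_iff)
    then show ?thesis
    proof cases
      case 1
      have "\<beta> \<circ> (w \<circ> ?s) = simple D i \<circ> ?s" using 1 by (simp add: comp_assoc[symmetric])
      then have "\<beta> \<circ> (w \<circ> ?s) = (\<lambda>h. - simple D i h)"
        using root_reflection_self[OF simple_root[OF i(1)]] by simp
      then show ?thesis using inj[OF 1] i(1) by (simp add: ht_neg ht_simple)
    next
      case 2
      then have "\<beta> \<circ> w \<circ> ?s \<in> pos_roots D" using simple_refl_pos i(1) by blast
      moreover have "\<beta> \<noteq> ?\<alpha>" using 2(2) simple_image_comp[OF w, of i] by auto
      ultimately show ?thesis using 2(1) by (simp add: pos_roots_iff comp_assoc)
    next
      case 3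
      have neg: "(\<lambda>h. - (\<beta> \<circ> w) h) \<in> pos_roots D" using neg_root_pos[OF root 3] .
      have "(\<lambda>h. - (\<beta> \<circ> w) h) \<noteq> simple D i"
      proof
        assume *: "(\<lambda>h. - (\<beta> \<circ> w) h) = simple D i"
        have "(\<lambda>h. - \<beta> h) \<circ> w = simple D i" using * by (simp add: comp_def)
        from simple_image_eqI[OF w this] have "ht ?\<alpha> = - ht \<beta>" by (simp add: ht_neg)
        then show False using pos \<beta> by (simp add: pos_roots_iff)
      qed
      from simple_refl_pos[OF i(1) neg this]
      have "(\<lambda>h. - \<beta> (w (?s h))) \<in> pos_roots D" by (simp add: comp_def)
      then have "0 < - ht (\<beta> \<circ> (w \<circ> ?s))"
        by (simp add: pos_roots_iff comp_def ht_neg)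
      then show ?thesis using 3 by linarith
    qed
  qed
  show "inversions (w \<circ> ?s) = insert ?\<alpha> (inversions w)"
    using eq pos by (auto simp: inversions_def)
qed

lemma card_inversions: "w \<in> Weyl D \<Longrightarrow> card (inversions w) = len D w"
proof (induction rule: Weyl_induct)
  case id
  have "inversions id = {}" by (auto simp: inversions_def pos_roots_iff)
  then show ?case by (simp add: len_id del: id_apply)
next
  case (ascent w i)
  then show ?case by (simp add: inversions_ascent finite_inversions len_ascent del: comp_apply)
qed

text \<open>
  The number of inversions bounds the length, so finitely many words suffice.
\<close>

lemma finite_Weyl: "finite (Weyl D)"
proof (rule finite_subset)
  show "finite (word D ` {js. set js \<subseteq> simple_indices \<and> length js \<le> card (pos_roots D)})"
    using finite_lists_length_le[of simple_indices] by simp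
  show "Weyl D \<subseteq> word D ` {js. set js \<subseteq> simple_indices \<and> length js \<le> card (pos_roots D)}"
  proof
    fix w assume w: "w \<in> Weyl D"
    then obtain js where js: "set js \<subseteq> simple_indices" "w = word D js" "length js = len D w"
      by (rule reduced_word)
    moreover have "len D w \<le> card (pos_roots D)"
      using card_mono[OF finite_pos_roots inversions_pos, of w] card_inversions[OF w] by simp
    ultimately show "w \<in> word D ` {js. set js \<subseteq> simple_indices \<and> length js \<le> card (pos_roots D)}"
      by auto
  qed
qed

section \<open>The Bruhat order\<close>

lemma Bruhat_step_Weyl: "Bruhat_step D u v \<Longrightarrow> u \<in> Weyl D \<and> v \<in> Weyl D"
  by (auto simp: Bruhat_step_def Weyl_reflection_comp pos_root)

lemma Bruhat_step_len: "Bruhat_step D u v \<Longrightarrow> len D u < len D v"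
  by (auto simp: Bruhat_step_def)

lemma Bruhat_le_refl: "Bruhat_le D u u"
  by (simp add: Bruhat_le_def)

lemma Bruhat_le_trans: "Bruhat_le D u v \<Longrightarrow> Bruhat_le D v w \<Longrightarrow> Bruhat_le D u w"
  by (simp add: Bruhat_le_def)

lemma Bruhat_le_step: "Bruhat_step D u v \<Longrightarrow> Bruhat_le D u v"
  by (simp add: Bruhat_le_def)

lemma Bruhat_le_Weyl: "Bruhat_le D u v \<Longrightarrow> u \<in> Weyl D \<Longrightarrow> v \<in> Weyl D"
  unfolding Bruhat_le_def by (induction rule: rtranclp_induct) (auto dest: Bruhat_step_Weyl)

lemma Bruhat_le_len: "Bruhat_le D u v \<Longrightarrow> u = v \<or> len D u < len D v"
  unfolding Bruhat_le_def by (induction rule: rtranclp_induct) (auto dest: Bruhat_step_len)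

lemma Bruhat_step_ascent:
  "w \<in> Weyl D \<Longrightarrow> i \<in> simple_indices \<Longrightarrow> ascent w i \<Longrightarrow> Bruhat_step D w (w \<circ> simple_refl i)"
  unfolding Bruhat_step_def
  by (auto simp: len_ascent ascent_iff reflection_simple_image intro!: bexI[of _ "simple_image w i"])

text \<open>
  The step is the reflection in \<open>\<beta>\<close> with \<open>u\<^sup>-\<^sup>1(\<beta>)\<close> positive. This root stays positive under the simple
  reflection unless it is the simple root itself, in which case the step is \<open>u < u s\<^sub>i\<close>.
\<close>

lemma Bruhat_step_comp_simple:
  assumes "Bruhat_step D u v" "i \<in> simple_indices"
  shows "Bruhat_step D (u \<circ> simple_refl i) (v \<circ> simple_refl i) \<or> v = u \<circ> simple_refl i"
proof -
  let ?s = "simple_refl i"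
  obtain \<beta> where u: "u \<in> Weyl D" and \<beta>: "\<beta> \<in> pos_roots D" and v: "v = reflection D \<beta> \<circ> u"
    and len: "len D u < len D v"
    using assms(1) by (auto simp: Bruhat_step_def)
  have pos: "\<beta> \<circ> u \<in> pos_roots D"
    using len v len_reflection_iff[OF u \<beta>] root_Weyl[OF u pos_root[OF \<beta>]] by (simp add: pos_roots_iff)
  show ?thesis
  proof (cases "\<beta> \<circ> u = simple D i")
    case True
    from simple_image_eqI[OF u True] reflection_simple_image[OF u assms(2)] show ?thesis
      by (simp add: v)
  next
    case False
    have "\<beta> \<circ> (u \<circ> ?s) \<in> pos_roots D"
      using simple_refl_pos[OF assms(2) pos False] by (simp add: comp_assoc)
    then have "len D (u \<circ> ?s) < len D (reflection D \<beta> \<circ> (u \<circ> ?s))"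
      using len_reflection_greater[OF Weyl_comp_simple[OF assms(2) u] \<beta>] by (simp add: pos_roots_iff)
    then show ?thesis
      using \<beta> Weyl_comp_simple[OF assms(2) u] by (auto simp: Bruhat_step_def v comp_assoc)
  qed
qed

text \<open>Both halves of the lifting property come from carrying a chain along the simple reflection.\<close>

lemma Bruhat_lift_descent:
  assumes "Bruhat_le D u v" "u \<in> Weyl D" "i \<in> simple_indices" "\<not> ascent u i"
  shows "Bruhat_le D (u \<circ> simple_refl i) (v \<circ> simple_refl i)"
  using assms(1) unfolding Bruhat_le_def
proof (induction rule: rtranclp_induct)
  case (step v v')
  let ?s = "simple_refl i"
  have "Bruhat_step D (u \<circ> ?s) u"
    using Bruhat_step_ascent[of "u \<circ> ?s" i] assms(2-4)
    by (simp add: Weyl_comp_simple ascent_comp_simple comp_simple_cancel)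
  then have u: "(Bruhat_step D)\<^sup>*\<^sup>* (u \<circ> ?s) v" using step.hyps(1) by simp
  from Bruhat_step_comp_simple[OF step.hyps(2) assms(3)] show ?case
  proof
    assume "v' = v \<circ> ?s"
    then have "v' \<circ> ?s = v" by (simp add: comp_simple_cancel[OF assms(3)])
    with u show ?thesis by (simp only:)
  next
    assume "Bruhat_step D (v \<circ> ?s) (v' \<circ> ?s)"
    then show ?thesis using step.IH by (rule rtranclp.rtrancl_into_rtrancl[rotated])
  qed
qed (rule rtranclp.rtrancl_refl)

lemma Bruhat_lift_ascent:
  assumes "Bruhat_le D u v" "u \<in> Weyl D" "i \<in> simple_indices" "ascent u i" "\<not> ascent v i"
  shows "Bruhat_le D u (v \<circ> simple_refl i)"
  using assms(1,2,4) unfolding Bruhat_le_def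
proof (induction rule: converse_rtranclp_induct)
  case base
  then show ?case using assms(5) by simp
next
  case (step u u')
  let ?s = "simple_refl i"
  have u': "u' \<in> Weyl D" using Bruhat_step_Weyl[OF step.hyps(1)] by simp
  show ?case
  proof (cases "ascent u' i")
    case True
    then show ?thesis using step u' by auto
  next
    case False
    have "Bruhat_le D (u' \<circ> ?s) (v \<circ> ?s)"
      using Bruhat_lift_descent[OF _ u' assms(3) False] step.hyps(2) by (simp add: Bruhat_le_def)
    moreover have "Bruhat_le D u (u' \<circ> ?s)"
      using Bruhat_step_comp_simple[OF step.hyps(1) assms(3)]
    proof
      assume "Bruhat_step D (u \<circ> ?s) (u' \<circ> ?s)"
      then show ?thesis
        using Bruhat_le_step[OF Bruhat_step_ascent[OF step.prems(1) assms(3) step.prems(2)]]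
          Bruhat_le_step Bruhat_le_trans by blast
    next
      assume "u' = u \<circ> ?s"
      then show ?thesis by (simp add: comp_simple_cancel[OF assms(3)] Bruhat_le_refl)
    qed
    ultimately have "Bruhat_le D u (v \<circ> ?s)" by (rule Bruhat_le_trans[rotated])
    then show ?thesis by (simp only: Bruhat_le_def)
  qed
qed

section \<open>Polynomial functions\<close>

lemma poly_funs_uminus: "f \<in> poly_funs D \<Longrightarrow> (\<lambda>h. - f h) \<in> poly_funs D"
  using poly_funs.mult[OF poly_funs.const[of "-1"], of f] by simp

lemma poly_funs_diff: "f \<in> poly_funs D \<Longrightarrow> g \<in> poly_funs D \<Longrightarrow> (\<lambda>h. f h - g h) \<in> poly_funs D"
  using poly_funs.add[of f D "\<lambda>h. - g h"] poly_funs_uminus[of g] by simp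

lemma poly_funs_root: "\<beta> \<in> roots D \<Longrightarrow> \<beta> \<in> poly_funs D"
  by (intro poly_funs.functional roots_dual)

lemma poly_funs_prod:
  assumes "finite A" "A \<subseteq> poly_funs D"
  shows "(\<lambda>h. \<Prod>\<alpha>\<in>A. \<alpha> h) \<in> poly_funs D"
  using assms by (induction A) (auto intro: poly_funs.const poly_funs.mult)

lemma poly_funs_scale: "f \<in> poly_funs D \<Longrightarrow> (\<lambda>h. f (scale D c h)) \<in> poly_funs D"
proof (induction rule: poly_funs.induct)
  case (functional l)
  then show ?case
    using poly_funs.mult[OF poly_funs.const poly_funs.functional] by (simp add: dual_scale)
qed (auto intro: poly_funs.intros)

text \<open>
  Restriction to lines reduces questions of vanishing to polynomials in one variable.
\<close>

lemma poly_funs_line: "f \<in> poly_funs D \<Longrightarrow> \<exists>q. \<forall>c. f (h + scale D c k) = poly q c"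
proof (induction rule: poly_funs.induct)
  case (const a)
  show ?case by (rule exI[of _ "[:a:]"]) simp
next
  case (functional l)
  then show ?case by (intro exI[of _ "[:l h, l k:]"]) (simp add: dual_add dual_scale)
next
  case (add f g)
  then obtain q r where "\<forall>c. f (h + scale D c k) = poly q c" "\<forall>c. g (h + scale D c k) = poly r c"
    by blast
  then show ?case by (intro exI[of _ "q + r"]) simp
next
  case (mult f g)
  then obtain q r where "\<forall>c. f (h + scale D c k) = poly q c" "\<forall>c. g (h + scale D c k) = poly r c"
    by blast
  then show ?case by (intro exI[of _ "q * r"]) simp
qed

lemma poly_zero_off_point:
  fixes q :: "complex poly"
  assumes "\<And>c. c \<noteq> a \<Longrightarrow> poly q c = 0"
  shows "q = 0"
proof (rule ccontr)
  assume "q \<noteq> 0"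
  then have "finite {c. poly q c = 0}" by (rule poly_roots_finite)
  moreover have "UNIV - {a} \<subseteq> {c. poly q c = 0}" using assms by auto
  ultimately have "finite (UNIV - {a})" by (rule finite_subset[rotated])
  then show False using infinite_UNIV_char_0[where ?'a = complex] by simp
qed

text \<open>
  A line in direction \<open>k\<close> meets the hyperplane \<open>\<alpha> = 0\<close> in one point only, and a polynomial that
  vanishes at all other points of the line vanishes there too.
\<close>

lemma poly_funs_zero_off_hyperplane:
  assumes "g \<in> poly_funs D" "\<alpha> \<in> dual D" "\<alpha> k \<noteq> 0"
    and zero: "\<And>c. \<alpha> (h + scale D c k) \<noteq> 0 \<Longrightarrow> g (h + scale D c k) = 0"
  shows "g h = 0"
proof -
  obtain q where q: "\<And>c. g (h + scale D c k) = poly q c" using poly_funs_line[OF assms(1)] by blast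
  have "q = 0"
  proof (rule poly_zero_off_point)
    fix c assume "c \<noteq> - \<alpha> h / \<alpha> k"
    then have "\<alpha> (h + scale D c k) \<noteq> 0"
      using assms(3) by (simp add: dual_add[OF assms(2)] dual_scale[OF assms(2)] field_simps eq_neg_iff_add_eq_0)
    from zero[OF this] q show "poly q c = 0" by simp
  qed
  then show ?thesis using q[of 0] by (simp add: scale_zero_left)
qed

lemma poly_funs_cancel:
  assumes "\<beta> \<in> roots D" "f \<in> poly_funs D" "g \<in> poly_funs D" "\<And>h. \<beta> h * f h = \<beta> h * g h"
  shows "f = g"
proof
  fix h
  have "f h - g h = 0"
    by (rule poly_funs_zero_off_hyperplane[OF poly_funs_diff[OF assms(2,3)] roots_dual[OF assms(1)],
          of "coroot D \<beta>"])
      (use assms(4) root_coroot[OF assms(1)] in auto)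
  then show "f h = g h" by simp
qed

text \<open>
  The statement is clear for functionals, and it passes to products by the product rule for
  differences.
\<close>

lemma poly_funs_taylor:
  assumes "f \<in> poly_funs D" "\<beta> \<in> dual D"
  shows "\<exists>g\<in>poly_funs D. \<forall>h. f h - f (h - scale D (\<beta> h) k) = \<beta> h * g h"
  using assms(1)
proof (induction rule: poly_funs.induct)
  case (const c)
  show ?case by (rule bexI[OF _ poly_funs.const[of 0]]) simp
next
  case (functional l)
  then show ?case
    by (intro bexI[OF _ poly_funs.const[of "l k"]]) (simp add: dual_diff dual_scale)
next
  case (add f1 f2)
  then obtain g1 g2 where g: "g1 \<in> poly_funs D" "g2 \<in> poly_funs D"
    "\<And>h. f1 h - f1 (h - scale D (\<beta> h) k) = \<beta> h * g1 h"
    "\<And>h. f2 h - f2 (h - scale D (\<beta> h) k) = \<beta> h * g2 h" by blast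
  have "f1 h + f2 h - (f1 (h - scale D (\<beta> h) k) + f2 (h - scale D (\<beta> h) k)) = \<beta> h * (g1 h + g2 h)" for h
    using g(3,4)[of h] by (simp only: add_diff_add ring_distribs)
  then show ?case by (intro bexI[OF _ poly_funs.add[OF g(1,2)]]) simp
next
  case (mult f1 f2)
  then obtain g1 g2 where g: "g1 \<in> poly_funs D" "g2 \<in> poly_funs D"
    "\<And>h. f1 h - f1 (h - scale D (\<beta> h) k) = \<beta> h * g1 h"
    "\<And>h. f2 h - f2 (h - scale D (\<beta> h) k) = \<beta> h * g2 h" by blast
  have poly: "(\<lambda>h. g1 h * f2 h + (f1 h - \<beta> h * g1 h) * g2 h) \<in> poly_funs D"
    using g mult.hyps poly_funs.functional[OF assms(2)]
    by (intro poly_funs.add poly_funs.mult poly_funs_diff)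
  have "f1 h * f2 h - f1 (h - scale D (\<beta> h) k) * f2 (h - scale D (\<beta> h) k)
      = \<beta> h * (g1 h * f2 h + (f1 h - \<beta> h * g1 h) * g2 h)" for h
  proof -
    have "f1 (h - scale D (\<beta> h) k) = f1 h - \<beta> h * g1 h" "f2 (h - scale D (\<beta> h) k) = f2 h - \<beta> h * g2 h"
      unfolding g(3,4)[of h, symmetric] by simp_all
    then show ?thesis by (simp only:) (simp add: algebra_simps)
  qed
  then show ?case by (intro bexI[OF _ poly]) simp
qed

text \<open>
  With \<open>k\<close> normalised by \<open>\<beta> k = 1\<close>, the point \<open>h - \<beta> h k\<close> is the projection of \<open>h\<close> to the hyperplane
  on which \<open>f\<close> vanishes.
\<close>

lemma root_divides:
  assumes "\<beta> \<in> roots D" "f \<in> poly_funs D" "\<And>h. \<beta> h = 0 \<Longrightarrow> f h = 0"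
  shows "\<exists>g\<in>poly_funs D. f = (\<lambda>h. \<beta> h * g h)"
proof -
  let ?k = "scale D (1 / 2) (coroot D \<beta>)"
  obtain g where g: "g \<in> poly_funs D" "\<And>h. f h - f (h - scale D (\<beta> h) ?k) = \<beta> h * g h"
    using poly_funs_taylor[OF assms(2) roots_dual[OF assms(1)]] by blast
  have "f (h - scale D (\<beta> h) ?k) = 0" for h
    by (rule assms(3)) (simp add: root_diff root_scale assms(1) root_coroot)
  with g show ?thesis by (intro bexI[of _ g]) (simp_all add: fun_eq_iff)
qed

text \<open>
  Functionals with nested kernels are proportional, and the root system is reduced.
\<close>

lemma roots_transversal:
  assumes "\<alpha> \<in> roots D" "\<beta> \<in> roots D" "\<alpha> \<noteq> \<beta>" "\<alpha> \<noteq> (\<lambda>h. - \<beta> h)"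
  shows "\<exists>k. \<beta> k = 0 \<and> \<alpha> k \<noteq> 0"
proof (rule ccontr)
  assume "\<nexists>k. \<beta> k = 0 \<and> \<alpha> k \<noteq> 0"
  then have ker: "\<And>k. \<beta> k = 0 \<Longrightarrow> \<alpha> k = 0" by blast
  define c where "c = \<alpha> (coroot D \<beta>) / 2"
  have "\<alpha> x = c * \<beta> x" for x
  proof -
    have "\<beta> (x - scale D (\<beta> x / 2) (coroot D \<beta>)) = 0"
      by (simp add: root_diff root_scale assms root_coroot)
    from ker[OF this] show ?thesis
      by (simp add: root_diff root_scale assms c_def)
  qed
  then have "\<alpha> = (\<lambda>h. c * \<beta> h)" by blast
  with roots_reduced[OF assms(2), of c] assms show False by auto
qed

lemma pos_roots_transversal:
  assumes "\<alpha> \<in> pos_roots D" "\<beta> \<in> pos_roots D" "\<alpha> \<noteq> \<beta>"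
  shows "\<exists>k. \<beta> k = 0 \<and> \<alpha> k \<noteq> 0"
proof (rule roots_transversal)
  show "\<alpha> \<noteq> (\<lambda>h. - \<beta> h)" using assms ht_neg[of \<beta>] by (auto simp: pos_roots_iff)
qed (use assms pos_root in auto)

text \<open>
  Distinct positive roots are coprime: after division by one root, the quotient still vanishes on
  the hyperplanes of the others, on which the first root is generically nonzero.
\<close>

lemma pos_roots_divide:
  assumes "finite A" "A \<subseteq> pos_roots D" "f \<in> poly_funs D"
    and "\<forall>\<beta>\<in>A. \<forall>h. \<beta> h = 0 \<longrightarrow> f h = 0"
  shows "\<exists>g\<in>poly_funs D. f = (\<lambda>h. (\<Prod>\<alpha>\<in>A. \<alpha> h) * g h)"
  using assms
proof (induction A arbitrary: f)
  case empty
  then show ?case by (intro bexI[of _ f]) simp_all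
next
  case (insert \<alpha> A)
  have \<alpha>: "\<alpha> \<in> pos_roots D" using insert.prems by simp
  obtain f' where f': "f' \<in> poly_funs D" "f = (\<lambda>h. \<alpha> h * f' h)"
    using root_divides[OF pos_root[OF \<alpha>] insert.prems(2)] insert.prems(3) by blast
  have "f' h = 0" if \<beta>: "\<beta> \<in> A" "\<beta> h = 0" for \<beta> h
  proof -
    have \<beta>': "\<beta> \<in> pos_roots D" "\<alpha> \<noteq> \<beta>" using insert.prems(1) insert.hyps(2) \<beta>(1) by auto
    then obtain k where k: "\<beta> k = 0" "\<alpha> k \<noteq> 0" using pos_roots_transversal[OF \<alpha>] by blast
    show ?thesis
    proof (rule poly_funs_zero_off_hyperplane[OF f'(1) roots_dual[OF pos_root[OF \<alpha>]] k(2)])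
      fix c assume nz: "\<alpha> (h + scale D c k) \<noteq> 0"
      have "\<beta> (h + scale D c k) = 0"
        using \<beta>(2) k(1) by (simp add: root_add root_scale pos_root \<beta>'(1))
      then have "f (h + scale D c k) = 0" using insert.prems(3) \<beta>(1) by blast
      then show "f' (h + scale D c k) = 0" using nz f'(2) by simp
    qed
  qed
  then obtain g where "g \<in> poly_funs D" "f' = (\<lambda>h. (\<Prod>\<alpha>\<in>A. \<alpha> h) * g h)"
    using insert.IH[OF _ f'(1)] insert.prems(1) by auto
  then show ?case using f'(2) insert.hyps by (intro bexI[of _ g]) (simp_all add: mult.assoc)
qed

lemma homogeneous_zero: "homogeneous D d (\<lambda>_. 0)"
  by (simp add: homogeneous_def)

lemma homogeneous_diff:
  "homogeneous D d f \<Longrightarrow> homogeneous D d g \<Longrightarrow> homogeneous D d (\<lambda>h. f h - g h)"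
  by (simp add: homogeneous_def algebra_simps)

lemma homogeneous_root_mult:
  "\<beta> \<in> roots D \<Longrightarrow> homogeneous D d f \<Longrightarrow> homogeneous D (Suc d) (\<lambda>h. \<beta> h * f h)"
  by (simp add: homogeneous_def root_scale)

lemma homogeneous_prod:
  assumes "A \<subseteq> roots D"
  shows "homogeneous D (card A) (\<lambda>h. \<Prod>\<alpha>\<in>A. \<alpha> h)"
proof -
  have "(\<Prod>\<alpha>\<in>A. \<alpha> (scale D c h)) = c ^ card A * (\<Prod>\<alpha>\<in>A. \<alpha> h)" for c h
  proof -
    have "(\<Prod>\<alpha>\<in>A. \<alpha> (scale D c h)) = (\<Prod>\<alpha>\<in>A. c * \<alpha> h)"
      using assms root_scale by (intro prod.cong) auto
    then show ?thesis by (simp add: prod.distrib)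
  qed
  then show ?thesis by (simp add: homogeneous_def)
qed

text \<open>
  On a line through the origin, \<open>f\<close> is of order \<open>d\<close> at the origin while the product already has the
  larger order \<open>card A\<close>.
\<close>

lemma homogeneous_divisible:
  assumes f: "homogeneous D d f" "f = (\<lambda>h. (\<Prod>\<alpha>\<in>A. \<alpha> h) * g h)"
    and A: "A \<subseteq> roots D" "d < card A" and g: "g \<in> poly_funs D"
  shows "f = (\<lambda>_. 0)"
proof
  fix h
  let ?P = "\<lambda>h. \<Prod>\<alpha>\<in>A. \<alpha> h"
  obtain q where q: "\<And>c. g (0 + scale D c h) = poly q c" using poly_funs_line[OF g] by blast
  \<comment> \<open>the value of \<open>f\<close> at \<open>c h\<close> in two ways, divided by \<open>c ^ d\<close>\<close>
  have "[:f h:] - monom (?P h) (card A - d) * q = 0"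
  proof (rule poly_zero_off_point[of 0])
    fix c :: complex assume c: "c \<noteq> 0"
    have "c ^ d * f h = f (scale D c h)" using f(1) by (simp add: homogeneous_def)
    also have "\<dots> = c ^ card A * ?P h * poly q c"
      using homogeneous_prod[OF A(1)] q[of c] f(2) by (simp add: homogeneous_def)
    also have "c ^ card A = c ^ d * c ^ (card A - d)" using A(2) by (simp add: power_add[symmetric])
    finally have "c ^ d * f h = c ^ d * (c ^ (card A - d) * ?P h * poly q c)"
      by (simp only: mult.assoc)
    then have "f h = c ^ (card A - d) * ?P h * poly q c" using c by simp
    then show "poly ([:f h:] - monom (?P h) (card A - d) * q) c = 0"
      by (simp add: poly_monom mult.commute)
  qed
  then have "poly ([:f h:] - monom (?P h) (card A - d) * q) 0 = 0" by simp
  then show "f h = 0" using A(2) by (simp add: poly_monom)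
qed

text \<open>
  Where \<open>\<beta>\<close> is nonzero it can be cancelled; the remaining points, and scaling by \<open>0\<close>, follow by
  continuation along lines.
\<close>

lemma homogeneous_quotient:
  assumes \<beta>: "\<beta> \<in> roots D" and g: "g \<in> poly_funs D" and f: "homogeneous D (Suc d) (\<lambda>h. \<beta> h * g h)"
  shows "homogeneous D d g"
  unfolding homogeneous_def
proof (intro allI)
  have nonzero: "g (scale D c h) = c ^ d * g h" if "c \<noteq> 0" for c h
  proof -
    have "g (scale D c h) - c ^ d * g h = 0"
    proof (rule poly_funs_zero_off_hyperplane[where g = "\<lambda>h. g (scale D c h) - c ^ d * g h" and k = "coroot D \<beta>"])
      show "(\<lambda>h. g (scale D c h) - c ^ d * g h) \<in> poly_funs D"
        by (rule poly_funs_diff[OF poly_funs_scale[OF g] poly_funs.mult[OF poly_funs.const g]])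
      fix a assume nz: "\<beta> (h + scale D a (coroot D \<beta>)) \<noteq> 0" (is "\<beta> ?x \<noteq> 0")
      have "\<beta> (scale D c ?x) * g (scale D c ?x) = c ^ Suc d * (\<beta> ?x * g ?x)"
        using f unfolding homogeneous_def by blast
      then have "(c * \<beta> ?x) * (g (scale D c ?x) - c ^ d * g ?x) = 0"
        by (simp add: root_scale \<beta> algebra_simps)
      then show "g (scale D c ?x) - c ^ d * g ?x = 0" using nz that by simp
    qed (use roots_dual[OF \<beta>] root_coroot[OF \<beta>] in auto)
    then show ?thesis by simp
  qed
  fix c h
  show "g (scale D c h) = c ^ d * g h"
  proof (cases "c = 0")
    case True
    obtain q where q: "\<And>a. g (0 + scale D a h) = poly q a" using poly_funs_line[OF g] by blast
    have "q - monom (g h) d = 0"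
      by (rule poly_zero_off_point[of 0]) (use nonzero in \<open>simp add: poly_monom q[symmetric]\<close>)
    then have "poly q 0 = poly (monom (g h) d) 0" by simp
    then show ?thesis using q[of 0] True by (simp add: poly_monom)
  qed (rule nonzero)
qed

lemma prod_pos_roots_rho_check:
  assumes "A \<subseteq> pos_roots D"
  shows "\<exists>n::nat. 0 < n \<and> (\<Prod>\<alpha>\<in>A. \<alpha> rho_check) = of_nat n"
proof -
  have "finite A" using finite_subset[OF assms finite_pos_roots] .
  then show ?thesis
    using assms
  proof (induction A)
    case empty
    show ?case by (rule exI[of _ 1]) simp
  next
    case (insert \<alpha> A)
    then obtain m n :: nat where "0 < m" "\<alpha> rho_check = of_nat m"
      "0 < n" "(\<Prod>\<alpha>\<in>A. \<alpha> rho_check) = of_nat n" using pos_root_rho_check[of \<alpha>] by auto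
    then show ?case using insert.hyps by (intro exI[of _ "m * n"]) simp
  qed
qed

section \<open>Classes on the Weyl group\<close>

text \<open>
  The conditions on classes in terms of values: by \<open>principal_ideal_root\<close>, a polynomial
  function lies in the ideal of a root if and only if it vanishes on the hyperplane of the root.
\<close>

definition gkm :: "(('t \<Rightarrow> 't) \<Rightarrow> 't \<Rightarrow> complex) \<Rightarrow> bool"
  where "gkm p \<longleftrightarrow> (\<forall>v\<in>Weyl D. p v \<in> poly_funs D) \<and>
    (\<forall>v\<in>Weyl D. \<forall>\<beta>\<in>pos_roots D. \<forall>h. \<beta> h = 0 \<longrightarrow> p (reflection D \<beta> \<circ> v) h = p v h)"

lemma gkm_poly: "gkm p \<Longrightarrow> v \<in> Weyl D \<Longrightarrow> p v \<in> poly_funs D"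
  by (simp add: gkm_def)

lemma gkmI:
  assumes "\<And>v. v \<in> Weyl D \<Longrightarrow> p v \<in> poly_funs D"
    and "\<And>v \<beta> h. v \<in> Weyl D \<Longrightarrow> \<beta> \<in> pos_roots D \<Longrightarrow> \<beta> h = 0 \<Longrightarrow> p (reflection D \<beta> \<circ> v) h = p v h"
  shows "gkm p"
  unfolding gkm_def using assms by blast

lemma gkm_pos:
  "gkm p \<Longrightarrow> v \<in> Weyl D \<Longrightarrow> \<beta> \<in> pos_roots D \<Longrightarrow> \<beta> h = 0 \<Longrightarrow> p (reflection D \<beta> \<circ> v) h = p v h"
  unfolding gkm_def by blast

lemma gkm_root:
  assumes "gkm p" "v \<in> Weyl D" "\<beta> \<in> roots D" "\<beta> h = 0"
  shows "p (reflection D \<beta> \<circ> v) h = p v h"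
proof (cases "0 < ht \<beta>")
  case True
  then have "\<beta> \<in> pos_roots D" using assms(3) by (simp add: pos_roots_iff)
  then show ?thesis using assms unfolding gkm_def by blast
next
  case False
  then have "(\<lambda>h. - \<beta> h) \<in> pos_roots D"
    using root_ht_cases[OF assms(3)] neg_root_pos[OF assms(3)] by blast
  moreover have "- \<beta> h = 0" using assms(4) by simp
  ultimately have "p (reflection D (\<lambda>h. - \<beta> h) \<circ> v) h = p v h"
    using assms(1,2) unfolding gkm_def by simp
  then show ?thesis by (simp only: reflection_neg[OF assms(3)])
qed

lemma gkm_simple:
  assumes "gkm p" "v \<in> Weyl D" "i \<in> simple_indices" "simple_image v i h = 0"
  shows "p (v \<circ> simple_refl i) h = p v h"
  using gkm_root[OF assms(1,2) simple_image_root[OF assms(2,3)] assms(4)]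
  unfolding reflection_simple_image[OF assms(2,3)] .

lemma gkm_diff:
  assumes "gkm p" "gkm q" shows "gkm (\<lambda>v h. p v h - q v h)"
  by (rule gkmI) (simp_all add: poly_funs_diff gkm_poly[OF assms(1)] gkm_poly[OF assms(2)]
      gkm_pos[OF assms(1)] gkm_pos[OF assms(2)])

lemma gkm_mult:
  assumes "gkm p" "gkm q" shows "gkm (\<lambda>v h. p v h * q v h)"
  by (rule gkmI) (simp_all add: poly_funs.mult gkm_poly[OF assms(1)] gkm_poly[OF assms(2)]
      gkm_pos[OF assms(1)] gkm_pos[OF assms(2)])

lemma gkm_const: "f \<in> poly_funs D \<Longrightarrow> gkm (\<lambda>_. f)"
  unfolding gkm_def by simp

text \<open>Right multiplication commutes with the left reflections in the conditions on classes.\<close>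

lemma gkm_comp_simple:
  assumes "gkm p" "i \<in> simple_indices" shows "gkm (\<lambda>v. p (v \<circ> simple_refl i))"
  using assms Weyl_comp_simple[OF assms(2)] unfolding gkm_def
  by (simp add: comp_assoc del: comp_apply)

lemma reflection_fixes: "\<beta> h = 0 \<Longrightarrow> reflection D \<beta> h = h"
  by (simp add: reflection_def scale_zero_left)

lemma gkm_simple_image:
  assumes "i \<in> simple_indices" shows "gkm (\<lambda>v. simple_image v i)"
proof (rule gkmI)
  show "simple_image v i \<in> poly_funs D" if "v \<in> Weyl D" for v
    by (rule poly_funs_root[OF simple_image_root[OF that assms]])
  show "simple_image (reflection D \<beta> \<circ> v) i h = simple_image v i h"
    if "v \<in> Weyl D" "\<beta> \<in> pos_roots D" "\<beta> h = 0" for v \<beta> h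
    using simple_image_reflection[OF that(1) pos_root[OF that(2)]] reflection_fixes[of \<beta> h] that(3) by simp
qed

text \<open>
  The value of a class at a vertex is divisible by the product of all positive roots on whose
  hyperplanes it vanishes.
\<close>

lemma gkm_degree:
  assumes "gkm p" "v \<in> Weyl D" "homogeneous D d (p v)" "p v \<noteq> (\<lambda>_. 0)"
    and A: "A \<subseteq> pos_roots D" "\<forall>\<beta>\<in>A. \<forall>h. \<beta> h = 0 \<longrightarrow> p v h = 0"
  shows "card A \<le> d"
proof (rule ccontr)
  assume "\<not> card A \<le> d"
  then have "d < card A" by simp
  have "finite A" using finite_subset[OF A(1) finite_pos_roots] .
  from pos_roots_divide[OF this A(1) gkm_poly[OF assms(1,2)] A(2)]
  obtain g where g: "g \<in> poly_funs D" "p v = (\<lambda>h. (\<Prod>\<alpha>\<in>A. \<alpha> h) * g h)" by blast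
  have "A \<subseteq> roots D" using A(1) pos_root by blast
  from homogeneous_divisible[OF assms(3) g(2) this \<open>d < card A\<close> g(1)] assms(4) show False by simp
qed

text \<open>
  The inversions of \<open>v\<close> are the edges from \<open>v\<close> to shorter elements, where the class vanishes.
\<close>

lemma gkm_vanish_inversion:
  assumes "gkm p" "v \<in> Weyl D" "\<And>u. u \<in> Weyl D \<Longrightarrow> len D u < len D v \<Longrightarrow> p u = (\<lambda>_. 0)"
  shows "\<forall>\<beta>\<in>inversions v. \<forall>h. \<beta> h = 0 \<longrightarrow> p v h = 0"
proof (intro ballI allI impI)
  fix \<beta> h assume "\<beta> \<in> inversions v" "\<beta> h = 0"
  have \<beta>: "\<beta> \<in> pos_roots D" "ht (\<beta> \<circ> v) < 0"
    using \<open>\<beta> \<in> inversions v\<close> by (auto simp: inversions_def)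
  have "p (reflection D \<beta> \<circ> v) = (\<lambda>_. 0)"
    by (rule assms(3))
      (use assms(2) \<beta> len_reflection_less Weyl_reflection_comp pos_root in auto)
  with gkm_root[OF assms(1,2) pos_root[OF \<beta>(1)] \<open>\<beta> h = 0\<close>] show "p v h = 0" by simp
qed

lemma Weyl_minimal:
  assumes "v \<in> Weyl D" "P v"
  obtains u where "u \<in> Weyl D" "P u" "\<And>x. x \<in> Weyl D \<Longrightarrow> len D x < len D u \<Longrightarrow> \<not> P x"
  using ex_has_least_nat[of "\<lambda>x. x \<in> Weyl D \<and> P x" v "len D"] assms by (metis not_le)

text \<open>
  The lowest nonzero value would be divisible by all \<open>len D v\<close> inversions of its vertex \<open>v\<close>, which
  exceeds the degree.
\<close>

lemma gkm_zero:
  assumes "gkm q" "\<And>v. v \<in> Weyl D \<Longrightarrow> homogeneous D d (q v)"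
    and "\<And>v. v \<in> Weyl D \<Longrightarrow> len D v \<le> d \<Longrightarrow> q v = (\<lambda>_. 0)"
    and "v \<in> Weyl D"
  shows "q v = (\<lambda>_. 0)"
proof (rule ccontr)
  assume "q v \<noteq> (\<lambda>_. 0)"
  then obtain u where u: "u \<in> Weyl D" "q u \<noteq> (\<lambda>_. 0)"
    "\<And>x. x \<in> Weyl D \<Longrightarrow> len D x < len D u \<Longrightarrow> \<not> q x \<noteq> (\<lambda>_. 0)"
    using Weyl_minimal[OF assms(4), of "\<lambda>v. q v \<noteq> (\<lambda>_. 0)"] by metis
  have lower: "q x = (\<lambda>_. 0)" if "x \<in> Weyl D" "len D x < len D u" for x
    using u(3)[OF that] by simp
  from gkm_degree[OF assms(1) u(1) assms(2)[OF u(1)] u(2) inversions_pos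
      gkm_vanish_inversion[OF assms(1) u(1) lower]]
  have "card (inversions u) \<le> d" .
  then show False using assms(3)[OF u(1)] u(2) card_inversions[OF u(1)] by simp
qed

text \<open>
  For a class that is antisymmetric under a right simple reflection, one more root divides the
  lowest value, which improves the degree bound by one.
\<close>

lemma gkm_zero_antisymmetric:
  assumes q: "gkm q" "\<And>v. v \<in> Weyl D \<Longrightarrow> homogeneous D d (q v)"
    and i: "i \<in> simple_indices"
    and anti: "\<And>v h. v \<in> Weyl D \<Longrightarrow> q (v \<circ> simple_refl i) h = - q v h"
    and low: "\<And>v. v \<in> Weyl D \<Longrightarrow> ascent v i \<Longrightarrow> len D v < d \<Longrightarrow> q v = (\<lambda>_. 0)"
    and "v \<in> Weyl D"
  shows "q v = (\<lambda>_. 0)"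
proof (rule ccontr)
  assume "q v \<noteq> (\<lambda>_. 0)"
  then obtain u where u: "u \<in> Weyl D" "q u \<noteq> (\<lambda>_. 0)"
    "\<And>x. x \<in> Weyl D \<Longrightarrow> len D x < len D u \<Longrightarrow> \<not> q x \<noteq> (\<lambda>_. 0)"
    using Weyl_minimal[OF \<open>v \<in> Weyl D\<close>, of "\<lambda>v. q v \<noteq> (\<lambda>_. 0)"] by metis
  have lower: "q x = (\<lambda>_. 0)" if "x \<in> Weyl D" "len D x < len D u" for x
    using u(3)[OF that] by simp
  have asc: "ascent u i"
  proof (rule ccontr)
    assume "\<not> ascent u i"
    then have "len D (u \<circ> simple_refl i) < len D u" using len_descent[OF u(1) i] by simp
    then have "q (u \<circ> simple_refl i) = (\<lambda>_. 0)"
      using lower[OF Weyl_comp_simple[OF i u(1)]] by blast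
    then have "q u h = 0" for h using anti[OF u(1), of h] by simp
    then show False using u(2) by blast
  qed
  have "q u h = 0" if \<beta>: "\<beta> \<in> inversions (u \<circ> simple_refl i)" "\<beta> h = 0" for \<beta> h
  proof -
    consider "\<beta> = simple_image u i" | "\<beta> \<in> inversions u"
      using inversions_ascent(1)[OF u(1) i asc] \<beta>(1) by blast
    then show ?thesis
    proof cases
      case 1
      then have "q (u \<circ> simple_refl i) h = q u h" using gkm_simple[OF q(1) u(1) i] \<beta>(2) by blast
      then show ?thesis using anti[OF u(1), of h] by simp
    next
      case 2
      then show ?thesis using gkm_vanish_inversion[OF q(1) u(1) lower] \<beta>(2) by blast
    qed
  qed
  then have "\<forall>\<beta>\<in>inversions (u \<circ> simple_refl i). \<forall>h. \<beta> h = 0 \<longrightarrow> q u h = 0" by blast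
  from gkm_degree[OF q(1) u(1) q(2)[OF u(1)] u(2) inversions_pos this]
  have "card (inversions (u \<circ> simple_refl i)) \<le> d" .
  then have "len D u < d"
    using card_inversions[OF Weyl_comp_simple[OF i u(1)]] len_ascent[OF u(1) i asc] by simp
  with low[OF u(1) asc] u(2) show False by blast
qed

section \<open>Schubert classes\<close>

text \<open>
  The conditions on a flow-up class with the degree made explicit and the support bounded from one
  side only; in this form they are inherited by divided differences. The exact support is
  recovered in \<open>schubert_class_support\<close>.
\<close>

definition schubert_class :: "('t \<Rightarrow> 't) \<Rightarrow> (('t \<Rightarrow> 't) \<Rightarrow> 't \<Rightarrow> complex) \<Rightarrow> bool"
  where "schubert_class w p \<longleftrightarrow> gkm p \<and> (\<forall>v\<in>Weyl D. homogeneous D (len D w) (p v)) \<and>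
    (\<forall>v\<in>Weyl D. p v \<noteq> (\<lambda>_. 0) \<longrightarrow> Bruhat_le D w v) \<and> p w = (\<lambda>h. \<Prod>\<alpha>\<in>inversions w. \<alpha> h)"

lemma schubert_classD:
  assumes "schubert_class w p"
  shows "gkm p" "v \<in> Weyl D \<Longrightarrow> homogeneous D (len D w) (p v)"
    "v \<in> Weyl D \<Longrightarrow> \<not> Bruhat_le D w v \<Longrightarrow> p v = (\<lambda>_. 0)"
    "p w = (\<lambda>h. \<Prod>\<alpha>\<in>inversions w. \<alpha> h)"
  using assms unfolding schubert_class_def by blast+

lemma schubert_class_low:
  "schubert_class w p \<Longrightarrow> v \<in> Weyl D \<Longrightarrow> v \<noteq> w \<Longrightarrow> len D v \<le> len D w \<Longrightarrow> p v = (\<lambda>_. 0)"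
  using schubert_classD(3)[of w p v] Bruhat_le_len[of w v] by auto

text \<open>
  A positive root \<open>\<beta>\<close> that is no inversion is \<open>w\<close> applied to a nonnegative combination of simple
  roots, all of whose images under \<open>w\<close> are negative.
\<close>

lemma inversions_longest:
  assumes w: "w \<in> Weyl D" and "\<And>i. i \<in> simple_indices \<Longrightarrow> \<not> ascent w i"
  shows "inversions w = pos_roots D"
proof (rule equalityI[OF inversions_pos subsetI])
  fix \<beta> assume \<beta>: "\<beta> \<in> pos_roots D"
  show "\<beta> \<in> inversions w"
  proof (rule ccontr)
    assume "\<beta> \<notin> inversions w"
    then have "\<beta> \<circ> w \<in> pos_roots D"
      using \<beta> root_Weyl[OF w pos_root[OF \<beta>]] root_ht_cases[OF root_Weyl[OF w pos_root[OF \<beta>]]]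
      by (auto simp: inversions_def pos_roots_iff)
    then obtain c where c: "\<beta> \<circ> w = (\<lambda>h. \<Sum>i\<in>simple_indices. of_nat (c i) * simple D i h)"
      by (rule pos_rootE)
    have "\<beta> rho_check = (\<beta> \<circ> w) (inv_into UNIV w rho_check)"
      using Weyl_bij[OF w] by (simp add: bij_is_surj surj_f_inv_f)
    also have "\<dots> = (\<Sum>i\<in>simple_indices. of_nat (c i) * simple_image w i rho_check)"
      unfolding c simple_image_def by simp
    finally have "ht \<beta> = (\<Sum>i\<in>simple_indices. real (c i) * ht (simple_image w i))"
      by (simp add: ht_def)
    also have "\<dots> \<le> 0"
      using assms(2) by (intro sum_nonpos mult_nonneg_nonpos) (auto simp: ascent_def not_less)
    finally show False using \<beta> by (simp add: pos_roots_iff)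
  qed
qed

text \<open>
  The class of a point: its only nonzero value is divisible by all positive roots, so the
  conditions along all edges hold.
\<close>

lemma schubert_class_longest:
  assumes w: "w \<in> Weyl D" and max: "\<And>i. i \<in> simple_indices \<Longrightarrow> \<not> ascent w i"
  shows "schubert_class w (\<lambda>v. if v = w then (\<lambda>h. \<Prod>\<alpha>\<in>pos_roots D. \<alpha> h) else (\<lambda>_. 0))"
proof -
  let ?p = "\<lambda>v. if v = w then (\<lambda>h. \<Prod>\<alpha>\<in>pos_roots D. \<alpha> h) else (\<lambda>_. 0)"
  have inv: "inversions w = pos_roots D" by (rule inversions_longest[OF assms])
  have sub: "pos_roots D \<subseteq> roots D" using pos_root by blast
  have zero: "?p v h = 0" if "\<beta> \<in> pos_roots D" "\<beta> h = 0" for \<beta> v h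
    using that finite_pos_roots by (auto intro: prod_zero)
  have "?p v \<in> poly_funs D" for v
    using poly_funs_prod[OF finite_pos_roots] sub poly_funs_root poly_funs.const by auto
  then have "gkm ?p" by (rule gkmI) (simp only: zero)
  moreover have "homogeneous D (len D w) (?p v)" for v
    using homogeneous_prod[OF sub] card_inversions[OF w] inv by (simp add: homogeneous_zero)
  moreover have "?p v \<noteq> (\<lambda>_. 0) \<longrightarrow> Bruhat_le D w v" for v
    by (simp add: Bruhat_le_refl)
  ultimately show ?thesis unfolding schubert_class_def by (simp only: inv) simp
qed

text \<open>
  The right divided difference of a class: the quotient is again a class because, for a reflection
  other than \<open>v s\<^sub>i v\<^sup>-\<^sup>1\<close>, the denominator is generically invertible on the reflecting hyperplane.
\<close>

lemma divided_difference:
  assumes p: "gkm p" and i: "i \<in> simple_indices"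
  obtains g where "gkm g"
    "\<And>v h. v \<in> Weyl D \<Longrightarrow> p (v \<circ> simple_refl i) h - p v h = simple_image v i h * g v h"
proof -
  have "\<exists>g\<in>poly_funs D. (\<lambda>h. p (v \<circ> simple_refl i) h - p v h) = (\<lambda>h. simple_image v i h * g h)"
    if v: "v \<in> Weyl D" for v
    by (rule root_divides[OF simple_image_root[OF v i] poly_funs_diff])
      (use gkm_poly[OF p] Weyl_comp_simple[OF i v] v gkm_simple[OF p v i] in auto)
  then obtain g where poly: "\<And>v. v \<in> Weyl D \<Longrightarrow> g v \<in> poly_funs D"
    and "\<And>v. v \<in> Weyl D \<Longrightarrow> (\<lambda>h. p (v \<circ> simple_refl i) h - p v h) = (\<lambda>h. simple_image v i h * g v h)"
    by metis
  then have g: "p (v \<circ> simple_refl i) h - p v h = simple_image v i h * g v h" if "v \<in> Weyl D" for v h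
    using that by (meson fun_cong)
  have "g (reflection D \<beta> \<circ> v) h = g v h"
    if v: "v \<in> Weyl D" and \<beta>: "\<beta> \<in> pos_roots D" and h: "\<beta> h = 0" for v \<beta> h
  proof -
    let ?\<gamma> = "simple_image v i" and ?u = "reflection D \<beta> \<circ> v"
    have u: "?u \<in> Weyl D" using v \<beta> by (simp add: Weyl_reflection_comp pos_root)
    have \<gamma>: "?\<gamma> \<in> roots D" using simple_image_root[OF v i] .
    \<comment> \<open>in the first case the reflection in \<open>\<beta>\<close> maps \<open>v\<close> to \<open>v s\<^sub>i\<close>, where the quotient is the same\<close>
    consider "reflection D \<beta> = reflection D ?\<gamma>" | "?\<gamma> \<noteq> \<beta>" "?\<gamma> \<noteq> (\<lambda>h. - \<beta> h)"
      using reflection_neg[OF pos_root[OF \<beta>]] by metis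
    then show ?thesis
    proof cases
      case 1
      let ?vs = "v \<circ> simple_refl i"
      have vs: "?vs \<in> Weyl D" using Weyl_comp_simple[OF i v] .
      have "?\<gamma> h * g ?vs h = ?\<gamma> h * g v h" for h
        using g[OF vs, of h] g[OF v, of h]
        unfolding comp_simple_cancel[OF i] simple_image_comp_simple[OF v i]
        by (simp add: algebra_simps)
      from poly_funs_cancel[OF \<gamma> poly[OF vs] poly[OF v] this] have "g ?vs = g v" .
      then show ?thesis using 1 reflection_simple_image[OF v i] by simp
    next
      case 2
      obtain k where k: "\<beta> k = 0" "?\<gamma> k \<noteq> 0"
        using roots_transversal[OF \<gamma> pos_root[OF \<beta>] 2] by blast
      have "g ?u h - g v h = 0"
      proof (rule poly_funs_zero_off_hyperplane[OF poly_funs_diff[OF poly[OF u] poly[OF v]]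
              roots_dual[OF \<gamma>] k(2)])
        fix c
        let ?x = "h + scale D c k"
        assume nz: "?\<gamma> ?x \<noteq> 0"
        have x: "\<beta> ?x = 0" using h k(1) by (simp add: root_add root_scale pos_root \<beta>)
        have "simple_image ?u i ?x = ?\<gamma> ?x"
          using simple_image_reflection[OF v pos_root[OF \<beta>]] reflection_fixes[of \<beta> ?x] x by simp
        then have "?\<gamma> ?x * g ?u ?x = p (reflection D \<beta> \<circ> (v \<circ> simple_refl i)) ?x - p ?u ?x"
          using g[OF u, of ?x] by (simp add: comp_assoc del: comp_apply)
        also have "\<dots> = ?\<gamma> ?x * g v ?x"
          unfolding gkm_root[OF p v pos_root[OF \<beta>] x]
            gkm_root[OF p Weyl_comp_simple[OF i v] pos_root[OF \<beta>] x]
          by (rule g[OF v])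
        finally show "g ?u ?x - g v ?x = 0" using nz by simp
      qed
      then show ?thesis by simp
    qed
  qed
  with poly have "gkm g" unfolding gkm_def by blast
  with that g show thesis by blast
qed

text \<open>
  The divided difference of the class of \<open>w s\<^sub>i\<close> has the right degree, the lifting property bounds its
  support, and its leading coefficient loses the factor \<open>w(\<alpha>\<^sub>i)\<close>.
\<close>

lemma schubert_class_step:
  assumes w: "w \<in> Weyl D" and i: "i \<in> simple_indices" and asc: "ascent w i"
    and p: "schubert_class (w \<circ> simple_refl i) p"
  shows "\<exists>g. schubert_class w g"
proof -
  let ?u = "w \<circ> simple_refl i"
  have u: "?u \<in> Weyl D" "\<not> ascent ?u i" using w i asc by (simp_all add: Weyl_comp_simple ascent_comp_simple)
  note D = schubert_classD[OF p]
  obtain g where g: "gkm g"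
    "\<And>v h. v \<in> Weyl D \<Longrightarrow> p (v \<circ> simple_refl i) h - p v h = simple_image v i h * g v h"
    using divided_difference[OF D(1) i] by blast
  have len: "len D ?u = Suc (len D w)" using len_ascent[OF w i asc] by simp
  have hom: "homogeneous D (len D w) (g v)" if v: "v \<in> Weyl D" for v
  proof (rule homogeneous_quotient[OF simple_image_root[OF v i] gkm_poly[OF g(1) v]])
    have "homogeneous D (len D ?u) (\<lambda>h. p (v \<circ> simple_refl i) h - p v h)"
      using D(2) v Weyl_comp_simple[OF i v] by (intro homogeneous_diff) auto
    then show "homogeneous D (Suc (len D w)) (\<lambda>h. simple_image v i h * g v h)"
      by (simp only: g(2)[OF v] len)
  qed
  have le: "Bruhat_le D w v" if v: "v \<in> Weyl D" and nz: "g v \<noteq> (\<lambda>_. 0)" for v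
  proof -
    have "\<exists>h. simple_image v i h * g v h \<noteq> simple_image v i h * 0"
      using poly_funs_cancel[OF simple_image_root[OF v i] gkm_poly[OF g(1) v] poly_funs.const] nz
      by metis
    then obtain h where "p (v \<circ> simple_refl i) h - p v h \<noteq> 0" using g(2)[OF v] by auto
    then have "p v \<noteq> (\<lambda>_. 0) \<or> p (v \<circ> simple_refl i) \<noteq> (\<lambda>_. 0)" by auto
    then show ?thesis
    proof
      assume "p v \<noteq> (\<lambda>_. 0)"
      then have "Bruhat_le D ?u v" using D(3)[OF v] by blast
      then show ?thesis
        using Bruhat_le_trans[OF Bruhat_le_step[OF Bruhat_step_ascent[OF w i asc]]] by blast
    next
      assume "p (v \<circ> simple_refl i) \<noteq> (\<lambda>_. 0)"
      then have "Bruhat_le D ?u (v \<circ> simple_refl i)" using D(3)[OF Weyl_comp_simple[OF i v]] by blast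
      from Bruhat_lift_descent[OF this u(1) i u(2)] show ?thesis
        by (simp only: comp_simple_cancel[OF i])
    qed
  qed
  have pw: "p w = (\<lambda>_. 0)"
    by (rule schubert_class_low[OF p w]) (use len in auto)
  have "g w = (\<lambda>h. \<Prod>\<alpha>\<in>inversions w. \<alpha> h)"
  proof (rule poly_funs_cancel[OF simple_image_root[OF w i] gkm_poly[OF g(1) w]])
    show "(\<lambda>h. \<Prod>\<alpha>\<in>inversions w. \<alpha> h) \<in> poly_funs D"
      using inversions_pos pos_root poly_funs_root by (intro poly_funs_prod[OF finite_inversions]) blast
    show "simple_image w i h * g w h = simple_image w i h * (\<Prod>\<alpha>\<in>inversions w. \<alpha> h)" for h
      using g(2)[OF w, of h] inversions_ascent[OF w i asc]
      by (auto simp add: D(4) pw finite_inversions simp del: comp_apply)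
  qed
  with g(1) hom le show ?thesis unfolding schubert_class_def by blast
qed

lemma schubert_class_exists:
  assumes "w \<in> Weyl D" shows "\<exists>p. schubert_class w p"
  using assms
proof (induction "card (pos_roots D) - len D w" arbitrary: w rule: less_induct)
  case less
  note w = less.prems
  show ?case
  proof (cases "\<exists>i\<in>simple_indices. ascent w i")
    case True
    then obtain i where i: "i \<in> simple_indices" "ascent w i" by blast
    have u: "w \<circ> simple_refl i \<in> Weyl D" using Weyl_comp_simple[OF i(1) w] .
    have "len D (w \<circ> simple_refl i) \<le> card (pos_roots D)"
      using card_mono[OF finite_pos_roots inversions_pos] card_inversions[OF u] by metis
    then have "card (pos_roots D) - len D (w \<circ> simple_refl i) < card (pos_roots D) - len D w"
      using len_ascent[OF w i] by simp
    from less.hyps[OF this u] schubert_class_step[OF w i] show ?thesis by blast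
  next
    case False
    then show ?thesis using schubert_class_longest[OF w] by blast
  qed
qed

text \<open>
  The difference of both sides is antisymmetric. At an ascent \<open>u\<close> shorter than \<open>w\<close> it could be
  nonzero only if \<open>u s\<^sub>i = w\<close>, but \<open>i\<close> is a descent of \<open>u s\<^sub>i\<close> and an ascent of \<open>w\<close>.
\<close>

lemma schubert_class_ascent:
  assumes p: "schubert_class w p" and w: "w \<in> Weyl D" and i: "i \<in> simple_indices" "ascent w i"
    and v: "v \<in> Weyl D"
  shows "p (v \<circ> simple_refl i) = p v"
proof -
  let ?q = "\<lambda>v h. p v h - p (v \<circ> simple_refl i) h"
  note D = schubert_classD[OF p]
  have "?q v = (\<lambda>_. 0)"
  proof (rule gkm_zero_antisymmetric[where q = ?q, OF _ _ i(1) _ _ v])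
    show "gkm ?q" by (rule gkm_diff[OF D(1) gkm_comp_simple[OF D(1) i(1)]])
    show "homogeneous D (len D w) (?q u)" if "u \<in> Weyl D" for u
      using that by (intro homogeneous_diff D(2) Weyl_comp_simple i(1))
    show "?q (u \<circ> simple_refl i) h = - ?q u h" for u h
      by (simp add: comp_simple_cancel[OF i(1)] del: comp_apply)
    fix u assume u: "u \<in> Weyl D" "ascent u i" "len D u < len D w"
    have "p u = (\<lambda>_. 0)" by (rule schubert_class_low[OF p u(1)]) (use u(3) in auto)
    moreover have "p (u \<circ> simple_refl i) = (\<lambda>_. 0)"
    proof (rule schubert_class_low[OF p Weyl_comp_simple[OF i(1) u(1)]])
      show "u \<circ> simple_refl i \<noteq> w" using i(2) u ascent_comp_simple[OF u(1) i(1)] by auto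
      show "len D (u \<circ> simple_refl i) \<le> len D w" using len_ascent[OF u(1) i(1) u(2)] u(3) by simp
    qed
    ultimately show "?q u = (\<lambda>_. 0)" by (simp del: comp_apply)
  qed
  then show ?thesis by (auto simp: fun_eq_iff simp del: comp_apply)
qed

text \<open>
  The recursion behind Billey's formula for the values of Schubert classes. The difference of both
  sides is antisymmetric. The only ascent shorter than \<open>w\<close> at which it could be nonzero is
  \<open>w s\<^sub>i\<close>, and there the leading coefficients of both classes match.
\<close>

lemma schubert_class_descent:
  assumes p: "schubert_class w p" and w: "w \<in> Weyl D" and i: "i \<in> simple_indices" "\<not> ascent w i"
    and p': "schubert_class (w \<circ> simple_refl i) p'" and v: "v \<in> Weyl D"
  shows "p (v \<circ> simple_refl i) h = p v h + simple_image v i h * p' v h"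
proof -
  let ?x = "w \<circ> simple_refl i"
  let ?q = "\<lambda>v h. p (v \<circ> simple_refl i) h - p v h - simple_image v i h * p' v h"
  have x: "?x \<in> Weyl D" "ascent ?x i" using w i by (simp_all add: Weyl_comp_simple ascent_comp_simple)
  have len: "len D w = Suc (len D ?x)" using len_descent[OF w i] by simp
  note D = schubert_classD[OF p] and D' = schubert_classD[OF p']
  have "?q v = (\<lambda>_. 0)"
  proof (rule gkm_zero_antisymmetric[where q = ?q, OF _ _ i(1) _ _ v])
    show "gkm ?q"
      by (intro gkm_diff gkm_mult gkm_simple_image gkm_comp_simple D(1) D'(1) i(1))
    show "homogeneous D (len D w) (?q u)" if u: "u \<in> Weyl D" for u
    proof (rule homogeneous_diff)
      show "homogeneous D (len D w) (\<lambda>h. p (u \<circ> simple_refl i) h - p u h)"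
        using u by (intro homogeneous_diff D(2) Weyl_comp_simple i(1))
      show "homogeneous D (len D w) (\<lambda>h. simple_image u i h * p' u h)"
        unfolding len by (rule homogeneous_root_mult[OF simple_image_root[OF u i(1)] D'(2)[OF u]])
    qed
    show "?q (u \<circ> simple_refl i) h = - ?q u h" if u: "u \<in> Weyl D" for u h
      using schubert_class_ascent[OF p' x(1) i(1) x(2) u] simple_image_comp_simple[OF u i(1)]
      by (simp add: comp_simple_cancel[OF i(1)] del: comp_apply)
    fix u assume u: "u \<in> Weyl D" "ascent u i" "len D u < len D w"
    have pu: "p u = (\<lambda>_. 0)" by (rule schubert_class_low[OF p u(1)]) (use u(3) in auto)
    show "?q u = (\<lambda>_. 0)"
    proof (cases "u = ?x")
      case True
      then have "u \<circ> simple_refl i = w" by (simp only: comp_simple_cancel[OF i(1)])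
      then show ?thesis
        using inversions_ascent[OF u(1) i(1) u(2)] D'(4)
        by (simp add: pu D(4) True[symmetric] finite_inversions del: comp_apply)
    next
      case False
      then have "u \<circ> simple_refl i \<noteq> w" by (metis comp_simple_cancel[OF i(1)])
      then have "p (u \<circ> simple_refl i) = (\<lambda>_. 0)"
        using schubert_class_low[OF p Weyl_comp_simple[OF i(1) u(1)]] len_ascent[OF u(1) i(1) u(2)] u(3)
        by simp
      moreover have "p' u = (\<lambda>_. 0)"
        using schubert_class_low[OF p' u(1) False] u(3) len by simp
      ultimately show ?thesis by (simp add: pu del: comp_apply)
    qed
  qed
  then have "?q v h = 0" by (rule fun_cong)
  then show ?thesis by (simp add: algebra_simps del: comp_apply)
qed

text \<open>
  By the recursion the values are sums of products of positive roots, so they do not cancel at a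
  point where all positive roots are positive.
\<close>

lemma schubert_class_positive:
  assumes "v \<in> Weyl D" "w \<in> Weyl D" "schubert_class w p"
  shows "\<exists>r\<ge>0. p v rho_check = of_real r \<and> (Bruhat_le D w v \<longrightarrow> 0 < r)"
  using assms
proof (induction arbitrary: w p rule: Weyl_induct)
  case id
  show ?case
  proof (cases "w = id")
    case True
    have "inversions id = {}" by (auto simp: inversions_def pos_roots_iff)
    then have "p id = (\<lambda>h. 1)" using schubert_classD(4)[OF id(2)] True by (simp del: id_apply)
    then show ?thesis by (intro exI[of _ 1]) (simp del: id_apply)
  next
    case False
    then have nle: "\<not> Bruhat_le D w id" using Bruhat_le_len[of w id] len_id by auto
    then have "p id = (\<lambda>_. 0)" using schubert_classD(3)[OF id(2) Weyl_id] by blast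
    then show ?thesis using nle by (intro exI[of _ 0]) (simp del: id_apply)
  qed
next
  case (ascent v i)
  let ?s = "simple_refl i"
  obtain r where r: "r \<ge> 0" "p v rho_check = of_real r" "Bruhat_le D w v \<longrightarrow> 0 < r"
    using ascent.IH[OF ascent.prems] by blast
  have vs: "v \<circ> ?s \<in> Weyl D" "\<not> ascent (v \<circ> ?s) i"
    using ascent.hyps by (simp_all add: Weyl_comp_simple ascent_comp_simple)
  show ?case
  proof (cases "ascent w i")
    case True
    have "p (v \<circ> ?s) = p v"
      using schubert_class_ascent[OF ascent.prems(2,1) ascent.hyps(2) True ascent.hyps(1)] .
    moreover have "Bruhat_le D w v" if "Bruhat_le D w (v \<circ> ?s)"
      using Bruhat_lift_ascent[OF that ascent.prems(1) ascent.hyps(2) True vs(2)]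
      by (simp only: comp_simple_cancel[OF ascent.hyps(2)])
    ultimately show ?thesis using r by (intro exI[of _ r]) (auto simp del: comp_apply)
  next
    case False
    have x: "w \<circ> ?s \<in> Weyl D" using Weyl_comp_simple[OF ascent.hyps(2) ascent.prems(1)] .
    obtain p' where p': "schubert_class (w \<circ> ?s) p'" using schubert_class_exists[OF x] by blast
    obtain r' where r': "r' \<ge> 0" "p' v rho_check = of_real r'" "Bruhat_le D (w \<circ> ?s) v \<longrightarrow> 0 < r'"
      using ascent.IH[OF x p'] by blast
    have "simple_image v i \<in> pos_roots D" using ascent.hyps ascent_iff by blast
    then obtain n :: nat where n: "0 < n" "simple_image v i rho_check = of_nat n"
      using pos_root_rho_check by blast
    have "p (v \<circ> ?s) rho_check = of_real (r + real n * r')"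
      using schubert_class_descent[OF ascent.prems(2,1) ascent.hyps(2) False p' ascent.hyps(1)]
      by (simp add: r(2) r'(2) n(2) del: comp_apply)
    moreover have "Bruhat_le D (w \<circ> ?s) v" if "Bruhat_le D w (v \<circ> ?s)"
      using Bruhat_lift_descent[OF that ascent.prems(1) ascent.hyps(2) False]
      by (simp only: comp_simple_cancel[OF ascent.hyps(2)])
    ultimately show ?thesis using r(1) r'(1,3) n(1)
      by (intro exI[of _ "r + real n * r'"]) (auto simp: add_nonneg_pos simp del: comp_apply)
  qed
qed

lemma schubert_class_support:
  assumes "schubert_class w p" "w \<in> Weyl D" "v \<in> Weyl D"
  shows "p v \<noteq> (\<lambda>_. 0) \<longleftrightarrow> Bruhat_le D w v"
  using schubert_class_positive[OF assms(3,2,1)] schubert_classD(3)[OF assms(1,3)] by auto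

text \<open>
  Two classes for \<open>w\<close> agree at \<open>w\<close> and vanish at all other elements that are not longer than \<open>w\<close>.
\<close>

lemma schubert_class_unique:
  assumes "schubert_class w p" "schubert_class w q" "w \<in> Weyl D" "v \<in> Weyl D"
  shows "p v = q v"
proof -
  let ?d = "\<lambda>v h. p v h - q v h"
  have "?d v = (\<lambda>_. 0)"
  proof (rule gkm_zero[where q = ?d, OF _ _ _ assms(4)])
    show "gkm ?d" using assms schubert_classD(1) by (intro gkm_diff) auto
    show "homogeneous D (len D w) (?d u)" if "u \<in> Weyl D" for u
      using that assms schubert_classD(2) by (intro homogeneous_diff) auto
    show "?d u = (\<lambda>_. 0)" if "u \<in> Weyl D" "len D u \<le> len D w" for u
      using that assms(1,2) schubert_class_low[of w _ u] schubert_classD(4)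
      by (cases "u = w") auto
  qed
  then show ?thesis by (auto simp: fun_eq_iff)
qed

section \<open>The algebras of classes\<close>

lemma Sym_simps:
  "carrier (Sym D) = poly_funs D" "f \<otimes>\<^bsub>Sym D\<^esub> g = (\<lambda>h. f h * g h)"
  "f \<oplus>\<^bsub>Sym D\<^esub> g = (\<lambda>h. f h + g h)" "\<one>\<^bsub>Sym D\<^esub> = (\<lambda>_. 1)" "\<zero>\<^bsub>Sym D\<^esub> = (\<lambda>_. 0)"
  by (simp_all add: Sym_def)

lemma cring_Sym: "cring (Sym D)"
proof (rule cringI)
  show "abelian_group (Sym D)"
  proof (rule abelian_groupI)
    fix f assume "f \<in> carrier (Sym D)"
    then show "\<exists>g\<in>carrier (Sym D). g \<oplus>\<^bsub>Sym D\<^esub> f = \<zero>\<^bsub>Sym D\<^esub>"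
      by (intro bexI[of _ "\<lambda>h. - f h"]) (auto simp: Sym_simps intro: poly_funs_uminus)
  qed (auto simp: Sym_simps algebra_simps intro: poly_funs.add poly_funs.const)
  show "Group.comm_monoid (Sym D)"
    by (rule comm_monoidI) (auto simp: Sym_simps algebra_simps intro: poly_funs.mult poly_funs.const)
qed (simp add: Sym_simps algebra_simps)

lemma Sym_minus:
  assumes "f \<in> poly_funs D" "g \<in> poly_funs D"
  shows "f \<ominus>\<^bsub>Sym D\<^esub> g = (\<lambda>h. f h - g h)"
proof -
  interpret cring "Sym D" by (rule cring_Sym)
  have "\<ominus>\<^bsub>Sym D\<^esub> g = (\<lambda>h. - g h)"
    by (rule minus_equality) (use assms(2) in \<open>auto simp: Sym_simps intro: poly_funs_uminus\<close>)
  then show ?thesis by (simp add: a_minus_def Sym_simps)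
qed

lemma principal_ideal_root:
  assumes "\<beta> \<in> roots D" "f \<in> poly_funs D"
  shows "f \<in> PIdl\<^bsub>Sym D\<^esub> \<beta> \<longleftrightarrow> (\<forall>h. \<beta> h = 0 \<longrightarrow> f h = 0)"
proof
  assume "f \<in> PIdl\<^bsub>Sym D\<^esub> \<beta>"
  then show "\<forall>h. \<beta> h = 0 \<longrightarrow> f h = 0" by (auto simp: cgenideal_def Sym_simps)
next
  assume "\<forall>h. \<beta> h = 0 \<longrightarrow> f h = 0"
  then obtain g where "g \<in> poly_funs D" "f = (\<lambda>h. \<beta> h * g h)"
    using root_divides[OF assms] by blast
  then show "f \<in> PIdl\<^bsub>Sym D\<^esub> \<beta>"
    by (auto simp: cgenideal_def Sym_simps mult.commute intro!: exI[of _ g])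
qed

text \<open>
  Classes on \<open>X\<close> are the functions whose pull-backs to the Weyl group are classes there: if \<open>\<pi>\<close>
  identifies the ends of an edge, the condition along this edge holds trivially for a pull-back.
\<close>

lemma carrier_GKM:
  assumes "\<pi> ` Weyl D \<subseteq> X"
  shows "p \<in> carrier (GKM D X \<pi>) \<longleftrightarrow> p \<in> X \<rightarrow>\<^sub>E poly_funs D \<and> gkm (\<lambda>w. p (\<pi> w))"
proof (cases "p \<in> X \<rightarrow>\<^sub>E poly_funs D")
  case True
  have poly: "p (\<pi> w) \<in> poly_funs D" if "w \<in> Weyl D" for w
    using True assms that by blast
  have "(\<pi> (reflection D \<alpha> \<circ> w) \<noteq> \<pi> w \<longrightarrow>
          p (\<pi> (reflection D \<alpha> \<circ> w)) \<ominus>\<^bsub>Sym D\<^esub> p (\<pi> w) \<in> PIdl\<^bsub>Sym D\<^esub> \<alpha>) \<longleftrightarrow>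
      (\<forall>h. \<alpha> h = 0 \<longrightarrow> p (\<pi> (reflection D \<alpha> \<circ> w)) h = p (\<pi> w) h)"
    if w: "w \<in> Weyl D" and \<alpha>: "\<alpha> \<in> pos_roots D" for w \<alpha>
  proof -
    have u: "reflection D \<alpha> \<circ> w \<in> Weyl D" using w \<alpha> by (simp add: Weyl_reflection_comp pos_root)
    show ?thesis
      using principal_ideal_root[OF pos_root[OF \<alpha>] poly_funs_diff[OF poly[OF u] poly[OF w]]]
      by (cases "\<pi> (reflection D \<alpha> \<circ> w) = \<pi> w") (simp_all add: Sym_minus[OF poly[OF u] poly[OF w]])
  qed
  then show ?thesis
    using True poly unfolding gkm_def by (simp add: GKM_def Sym_simps(1) del: comp_apply)
qed (simp add: GKM_def Sym_simps(1))

lemma GKM_simps: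
  "p \<otimes>\<^bsub>GKM D X \<pi>\<^esub> q = (\<lambda>x\<in>X. \<lambda>h. p x h * q x h)" "\<one>\<^bsub>GKM D X \<pi>\<^esub> = (\<lambda>x\<in>X. \<lambda>_. 1)"
  "p \<oplus>\<^bsub>GKM D X \<pi>\<^esub> q = (\<lambda>x\<in>X. \<lambda>h. p x h + q x h)" "\<zero>\<^bsub>GKM D X \<pi>\<^esub> = (\<lambda>x\<in>X. \<lambda>_. 0)"
  "c \<odot>\<^bsub>GKM D X \<pi>\<^esub> p = (\<lambda>x\<in>X. \<lambda>h. c h * p x h)"
  by (simp_all add: GKM_def Sym_simps)

text \<open>Closure under multiplication by constants provides the zero and the additive inverses.\<close>

lemma algebra_GKM_subset:
  assumes K: "K \<subseteq> X \<rightarrow>\<^sub>E poly_funs D" "(\<lambda>x\<in>X. \<lambda>_. 1) \<in> K"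
    and add: "\<And>p q. p \<in> K \<Longrightarrow> q \<in> K \<Longrightarrow> (\<lambda>x\<in>X. \<lambda>h. p x h + q x h) \<in> K"
    and mult: "\<And>p q. p \<in> K \<Longrightarrow> q \<in> K \<Longrightarrow> (\<lambda>x\<in>X. \<lambda>h. p x h * q x h) \<in> K"
    and smult: "\<And>c p. c \<in> poly_funs D \<Longrightarrow> p \<in> K \<Longrightarrow> (\<lambda>x\<in>X. \<lambda>h. c h * p x h) \<in> K"
  shows "algebra (Sym D) (GKM D X \<pi>\<lparr>carrier := K\<rparr>)" (is "algebra _ ?M")
proof -
  have ext: "(\<lambda>x\<in>X. p x) = p" if "p \<in> K" for p
    using PiE_restrict[OF subsetD[OF K(1) that]] .
  have zero: "(\<lambda>x\<in>X. \<lambda>_. 0) \<in> K"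
    using smult[OF poly_funs.const[of 0] K(2)] by (simp cong: restrict_cong)
  have ops: "p \<otimes>\<^bsub>?M\<^esub> q = (\<lambda>x\<in>X. \<lambda>h. p x h * q x h)" "\<one>\<^bsub>?M\<^esub> = (\<lambda>x\<in>X. \<lambda>_. 1)"
    "p \<oplus>\<^bsub>?M\<^esub> q = (\<lambda>x\<in>X. \<lambda>h. p x h + q x h)" "\<zero>\<^bsub>?M\<^esub> = (\<lambda>x\<in>X. \<lambda>_. 0)"
    "c \<odot>\<^bsub>?M\<^esub> p = (\<lambda>x\<in>X. \<lambda>h. c h * p x h)" "carrier ?M = K" for p q c
    using GKM_simps by simp_all
  have group: "abelian_group ?M"
  proof (rule abelian_groupI)
    fix p assume p: "p \<in> carrier ?M"
    then show "\<exists>q\<in>carrier ?M. q \<oplus>\<^bsub>?M\<^esub> p = \<zero>\<^bsub>?M\<^esub>"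
      using smult[OF poly_funs.const[of "-1"], of p] unfolding ops
      by (intro bexI[of _ "\<lambda>x\<in>X. \<lambda>h. - 1 * p x h"]) (auto cong: restrict_cong)
    show "\<zero>\<^bsub>?M\<^esub> \<oplus>\<^bsub>?M\<^esub> p = p"
      using ext[of p] p unfolding ops by (simp cong: restrict_cong)
  qed (auto simp: ops GKM_simps add zero algebra_simps cong: restrict_cong)
  have monoid: "Group.comm_monoid ?M"
  proof (rule comm_monoidI)
    fix p assume p: "p \<in> carrier ?M"
    show "\<one>\<^bsub>?M\<^esub> \<otimes>\<^bsub>?M\<^esub> p = p"
      using ext[of p] p unfolding ops by (simp cong: restrict_cong)
  qed (auto simp: ops GKM_simps mult K(2) algebra_simps cong: restrict_cong)
  have "cring ?M"
    by (rule cringI[OF group monoid]) (auto simp: ops GKM_simps algebra_simps cong: restrict_cong)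
  then show ?thesis
  proof (rule algebraI[OF cring_Sym])
    fix p assume p: "p \<in> carrier ?M"
    show "\<one>\<^bsub>Sym D\<^esub> \<odot>\<^bsub>?M\<^esub> p = p"
      using ext[of p] p unfolding ops Sym_simps by (simp cong: restrict_cong)
  qed (auto simp: ops GKM_simps Sym_simps smult algebra_simps cong: restrict_cong)
qed

lemma gkm_cong:
  assumes "gkm p" "\<And>v. v \<in> Weyl D \<Longrightarrow> q v = p v" shows "gkm q"
  using assms(1) by (intro gkmI)
    (simp_all add: assms(2) gkm_poly gkm_pos Weyl_reflection_comp pos_root)

lemma gkm_add:
  assumes "gkm p" "gkm q" shows "gkm (\<lambda>v h. p v h + q v h)"
  by (rule gkmI) (simp_all add: poly_funs.add gkm_poly[OF assms(1)] gkm_poly[OF assms(2)]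
      gkm_pos[OF assms(1)] gkm_pos[OF assms(2)])

lemma GKM_closed:
  assumes \<pi>: "\<pi> ` Weyl D \<subseteq> X"
  shows "(\<lambda>x\<in>X. \<lambda>_. 1) \<in> carrier (GKM D X \<pi>)"
    and "p \<in> carrier (GKM D X \<pi>) \<Longrightarrow> q \<in> carrier (GKM D X \<pi>) \<Longrightarrow>
      (\<lambda>x\<in>X. \<lambda>h. p x h + q x h) \<in> carrier (GKM D X \<pi>)"
    and "p \<in> carrier (GKM D X \<pi>) \<Longrightarrow> q \<in> carrier (GKM D X \<pi>) \<Longrightarrow>
      (\<lambda>x\<in>X. \<lambda>h. p x h * q x h) \<in> carrier (GKM D X \<pi>)"
    and "c \<in> poly_funs D \<Longrightarrow> p \<in> carrier (GKM D X \<pi>) \<Longrightarrow>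
      (\<lambda>x\<in>X. \<lambda>h. c h * p x h) \<in> carrier (GKM D X \<pi>)"
proof -
  have X: "\<pi> v \<in> X" if "v \<in> Weyl D" for v using that \<pi> by blast
  note iff = carrier_GKM[OF \<pi>]
  show "(\<lambda>x\<in>X. \<lambda>_. 1) \<in> carrier (GKM D X \<pi>)"
    unfolding iff using poly_funs.const
    by (auto intro: gkm_cong[OF gkm_const[OF poly_funs.const[of 1]]] simp: X)
  show "(\<lambda>x\<in>X. \<lambda>h. p x h + q x h) \<in> carrier (GKM D X \<pi>)"
    if "p \<in> carrier (GKM D X \<pi>)" "q \<in> carrier (GKM D X \<pi>)"
    using that unfolding iff
    by (auto intro!: gkm_cong[OF gkm_add, of "\<lambda>w. p (\<pi> w)" "\<lambda>w. q (\<pi> w)"] poly_funs.add simp: X)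
  show "(\<lambda>x\<in>X. \<lambda>h. p x h * q x h) \<in> carrier (GKM D X \<pi>)"
    if "p \<in> carrier (GKM D X \<pi>)" "q \<in> carrier (GKM D X \<pi>)"
    using that unfolding iff
    by (auto intro!: gkm_cong[OF gkm_mult, of "\<lambda>w. p (\<pi> w)" "\<lambda>w. q (\<pi> w)"] poly_funs.mult simp: X)
  show "(\<lambda>x\<in>X. \<lambda>h. c h * p x h) \<in> carrier (GKM D X \<pi>)"
    if "c \<in> poly_funs D" "p \<in> carrier (GKM D X \<pi>)"
    using that unfolding iff
    by (auto intro!: gkm_cong[OF gkm_mult[OF gkm_const], of c "\<lambda>w. p (\<pi> w)"] poly_funs.mult simp: X)
qed

lemma algebra_GKM:
  assumes "\<pi> ` Weyl D \<subseteq> X"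
  shows "algebra (Sym D) (GKM D X \<pi>)"
proof -
  have "algebra (Sym D) (GKM D X \<pi>\<lparr>carrier := carrier (GKM D X \<pi>)\<rparr>)"
    by (rule algebra_GKM_subset) (use carrier_GKM[OF assms] GKM_closed[OF assms] in auto)
  then show ?thesis by simp
qed

lemma carrier_HT_GB: "p \<in> carrier (HT_GB D) \<longleftrightarrow> p \<in> Weyl D \<rightarrow>\<^sub>E poly_funs D \<and> gkm p"
  by (simp add: HT_GB_def carrier_GKM)

lemma carrier_HT_GP:
  "p \<in> carrier (HT_GP D J) \<longleftrightarrow>
    p \<in> coset D J ` Weyl D \<rightarrow>\<^sub>E poly_funs D \<and> gkm (\<lambda>w. p (coset D J w))"
  by (simp add: HT_GP_def carrier_GKM)

section \<open>Flow-up classes\<close>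

lemma inversions_eq:
  assumes "w \<in> Weyl D"
  shows "{\<alpha>. \<alpha> \<in> pos_roots D \<and> (\<lambda>x. - \<alpha> (w x)) \<in> pos_roots D} = inversions w"
proof -
  have "(\<lambda>x. - \<alpha> (w x)) \<in> pos_roots D \<longleftrightarrow> ht (\<alpha> \<circ> w) < 0" if \<alpha>: "\<alpha> \<in> pos_roots D" for \<alpha>
    using root_neg[OF root_Weyl[OF assms pos_root[OF \<alpha>]]] ht_neg[of "\<alpha> \<circ> w"]
    by (simp add: pos_roots_iff)
  then show ?thesis by (auto simp: inversions_def simp del: comp_apply)
qed

text \<open>
  The degree of a flow-up class is determined by its value at \<open>w\<close>, a product of \<open>len D w\<close> roots that
  is nonzero at \<open>rho_check\<close>: compare the values there and at twice this point.
\<close>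

lemma is_flow_up_iff:
  assumes w: "w \<in> Weyl D"
  shows "is_flow_up D w p \<longleftrightarrow> p \<in> extensional (Weyl D) \<and> schubert_class w p"
proof
  assume flow: "is_flow_up D w p"
  then obtain d where hom: "\<And>v. v \<in> Weyl D \<Longrightarrow> homogeneous D d (p v)"
    by (auto simp: is_flow_up_def)
  have pw: "p w = (\<lambda>h. \<Prod>\<alpha>\<in>inversions w. \<alpha> h)"
    using flow unfolding is_flow_up_def inversions_eq[OF w] by blast
  have "inversions w \<subseteq> roots D" using inversions_pos pos_root by blast
  from homogeneous_prod[OF this] have "homogeneous D (len D w) (p w)"
    by (simp only: pw card_inversions[OF w])
  with hom[OF w] have "2 ^ d * p w rho_check = 2 ^ len D w * p w rho_check"
    unfolding homogeneous_def by metis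
  moreover have "p w rho_check \<noteq> 0"
    using prod_pos_roots_rho_check[OF inversions_pos, of w] by (auto simp: pw)
  ultimately have "(2::complex) ^ d = 2 ^ len D w" by simp
  then have "(of_nat (2 ^ d) :: complex) = of_nat (2 ^ len D w)" by simp
  then have "d = len D w" by (simp only: of_nat_eq_iff) simp
  with hom pw flow show "p \<in> extensional (Weyl D) \<and> schubert_class w p"
    by (auto simp: is_flow_up_def schubert_class_def carrier_HT_GB Sym_simps PiE_def)
next
  assume p: "p \<in> extensional (Weyl D) \<and> schubert_class w p"
  then have "p \<in> carrier (HT_GB D)"
    using schubert_classD(1)[of w p] gkm_poly by (auto simp: carrier_HT_GB PiE_def)
  moreover have "\<forall>v\<in>Weyl D. p v \<noteq> \<zero>\<^bsub>Sym D\<^esub> \<longleftrightarrow> Bruhat_le D w v"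
    using schubert_class_support[OF _ w] p by (simp add: Sym_simps)
  moreover have "\<exists>d. \<forall>v\<in>Weyl D. homogeneous D d (p v)"
    "p w = (\<lambda>h. \<Prod>\<alpha>\<in>inversions w. \<alpha> h)"
    using p schubert_classD by blast+
  ultimately show "is_flow_up D w p" unfolding is_flow_up_def inversions_eq[OF w] by blast
qed

lemma flow_up_schubert_class:
  assumes w: "w \<in> Weyl D"
  shows "schubert_class w (flow_up D w)" "flow_up D w \<in> carrier (HT_GB D)"
proof -
  obtain p where p: "schubert_class w p" using schubert_class_exists[OF w] by blast
  let ?p = "\<lambda>v\<in>Weyl D. p v"
  have "schubert_class w ?p"
    using p w gkm_cong[of p ?p] by (simp add: schubert_class_def)
  then have flow: "is_flow_up D w ?p" by (simp add: is_flow_up_iff[OF w])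
  have "q = ?p" if "is_flow_up D w q" for q
  proof (rule extensionalityI[of _ "Weyl D"])
    show "q \<in> extensional (Weyl D)" using that is_flow_up_iff[OF w] by blast
    show "q v = ?p v" if "v \<in> Weyl D" for v
      using schubert_class_unique[OF _ _ w that] flow \<open>is_flow_up D w q\<close> is_flow_up_iff[OF w] by blast
  qed simp
  then have "is_flow_up D w (flow_up D w)"
    unfolding flow_up_def using theI[of "is_flow_up D w", OF flow] by blast
  then show "schubert_class w (flow_up D w)" using is_flow_up_iff[OF w] by blast
  show "flow_up D w \<in> carrier (HT_GB D)"
    using \<open>is_flow_up D w (flow_up D w)\<close> unfolding is_flow_up_def by (elim conjE)
qed

end

section \<open>Cosets of the parabolic subgroup and invariant classes\<close>

locale parabolic = semisimple_roots D for D :: "('t::ab_group_add) root_data" +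
  fixes J :: "nat set"
  assumes J: "J \<subseteq> {1..rank D}"
begin

lemma parabolic_Weyl_Weyl: "u \<in> parabolic_Weyl D J \<Longrightarrow> u \<in> Weyl D"
  using parabolic_Weyl_iff[OF J] Weyl_iff J by blast

lemma parabolic_id: "id \<in> parabolic_Weyl D J"
  unfolding parabolic_Weyl_iff[OF J] by (rule exI[of _ "[]"]) (simp add: word_Nil del: id_apply)

lemma parabolic_simple: "j \<in> J \<Longrightarrow> simple_refl j \<in> parabolic_Weyl D J"
  unfolding parabolic_Weyl_iff[OF J] by (rule exI[of _ "[j]"]) (simp add: word_Cons word_Nil)

lemma parabolic_comp:
  assumes "u \<in> parabolic_Weyl D J" "v \<in> parabolic_Weyl D J" shows "u \<circ> v \<in> parabolic_Weyl D J"
proof -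
  obtain xs ys where "set xs \<subseteq> J" "u = word D xs" "set ys \<subseteq> J" "v = word D ys"
    using assms unfolding parabolic_Weyl_iff[OF J] by blast
  then show ?thesis
    unfolding parabolic_Weyl_iff[OF J] by (intro exI[of _ "xs @ ys"]) (simp add: word_append)
qed

lemma parabolic_inverse:
  assumes "u \<in> parabolic_Weyl D J" obtains v where "v \<in> parabolic_Weyl D J" "u \<circ> v = id"
proof -
  obtain js where js: "set js \<subseteq> J" "u = word D js"
    using assms unfolding parabolic_Weyl_iff[OF J] by blast
  then have "set (rev js) \<subseteq> J" "u \<circ> word D (rev js) = id"
    using J word_rev_cancel[of "rev js"] by auto
  then have "word D (rev js) \<in> parabolic_Weyl D J" "u \<circ> word D (rev js) = id"
    unfolding parabolic_Weyl_iff[OF J] by blast+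
  then show thesis by (rule that)
qed

lemma coset_iff: "v \<in> coset D J w \<longleftrightarrow> (\<exists>u\<in>parabolic_Weyl D J. v = w \<circ> u)"
  by (auto simp: coset_def)

lemma coset_self: "w \<in> coset D J w"
  unfolding coset_iff by (rule bexI[OF _ parabolic_id]) simp

lemma coset_Weyl: "w \<in> Weyl D \<Longrightarrow> v \<in> coset D J w \<Longrightarrow> v \<in> Weyl D"
  using Weyl_comp parabolic_Weyl_Weyl by (auto simp: coset_iff)

lemma coset_eq:
  assumes "v \<in> coset D J w" shows "coset D J v = coset D J w"
proof -
  have sub: "coset D J (w \<circ> u) \<subseteq> coset D J w" if "u \<in> parabolic_Weyl D J" for w u
    using parabolic_comp[OF that] by (fastforce simp: coset_iff comp_assoc)
  obtain u where u: "u \<in> parabolic_Weyl D J" "v = w \<circ> u" using assms by (auto simp: coset_iff)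
  obtain u' where u': "u' \<in> parabolic_Weyl D J" "u \<circ> u' = id" using parabolic_inverse[OF u(1)] .
  have "v \<circ> u' = w" by (simp only: u(2) comp_assoc u'(2) comp_id)
  then show ?thesis using sub[OF u(1), of w] sub[OF u'(1), of v] unfolding u(2) by (simp only:)
qed

definition invariant_classes :: "(('t \<Rightarrow> 't) \<Rightarrow> 't \<Rightarrow> complex) set"
  where "invariant_classes =
    {p \<in> carrier (HT_GB D). \<forall>v\<in>Weyl D. \<forall>j\<in>J. p (v \<circ> simple_refl j) = p v}"

lemma invariant_coset:
  assumes p: "p \<in> invariant_classes" and v: "v \<in> Weyl D" and x: "x \<in> coset D J v"
  shows "p x = p v"
proof -
  obtain u where u: "u \<in> parabolic_Weyl D J" "x = v \<circ> u" using x by (auto simp: coset_iff)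
  then obtain js where js: "set js \<subseteq> J" "u = word D js" unfolding parabolic_Weyl_iff[OF J] by blast
  have "p (v \<circ> word D js) = p v" using js(1) v
  proof (induction js arbitrary: v)
    case Nil
    then show ?case by (simp add: word_Nil)
  next
    case (Cons j js)
    then have j: "j \<in> J" "v \<circ> simple_refl j \<in> Weyl D" using J by (auto intro!: Weyl_comp_simple)
    have "p (v \<circ> word D (j # js)) = p (v \<circ> simple_refl j \<circ> word D js)"
      by (simp only: word_Cons comp_assoc)
    also have "\<dots> = p (v \<circ> simple_refl j)" using Cons.IH[OF _ j(2)] Cons.prems(1) by (simp del: comp_apply)
    also have "\<dots> = p v" using p Cons.prems(2) j(1) by (simp add: invariant_classes_def)
    finally show ?case .
  qed
  then show ?thesis using u js by simp
qed

lemma min_reps_ascent: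
  assumes "w \<in> min_reps D J" "j \<in> J" shows "w \<in> Weyl D" "ascent w j"
proof -
  show w: "w \<in> Weyl D" using assms(1) by (simp add: min_reps_def)
  have "w \<circ> simple_refl j \<in> coset D J w" using parabolic_simple[OF assms(2)] by (auto simp: coset_iff)
  then have "len D w \<le> len D (w \<circ> simple_refl j)" using assms(1) by (simp add: min_reps_def)
  then show "ascent w j" using len_descent[OF w, of j] assms(2) J by fastforce
qed

lemma min_reps_Weyl: "w \<in> min_reps D J \<Longrightarrow> w \<in> Weyl D"
  by (simp add: min_reps_def)

lemma flow_up_invariant:
  assumes "w \<in> min_reps D J" shows "flow_up D w \<in> invariant_classes"
  unfolding invariant_classes_def
proof (intro CollectI conjI ballI)
  note w = min_reps_Weyl[OF assms]
  show "flow_up D w \<in> carrier (HT_GB D)" using flow_up_schubert_class[OF w] by simp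
  fix v j assume "v \<in> Weyl D" "j \<in> J"
  then show "flow_up D w (v \<circ> simple_refl j) = flow_up D w v"
    using schubert_class_ascent[OF flow_up_schubert_class(1)[OF w] w _ min_reps_ascent(2)[OF assms]] J
    by blast
qed

text \<open>
  The flow-up class of a minimal representative \<open>w\<close> is constant, hence nonzero, on the coset of \<open>w\<close>,
  so \<open>w\<close> is below every element of its coset.
\<close>

lemma inj_on_coset: "inj_on (coset D J) (min_reps D J)"
proof (rule inj_onI)
  fix w v assume w: "w \<in> min_reps D J" and v: "v \<in> min_reps D J" and eq: "coset D J w = coset D J v"
  note W = min_reps_Weyl[OF w] min_reps_Weyl[OF v]
  have vw: "v \<in> coset D J w" "w \<in> coset D J v" using eq coset_self by blast+
  have "flow_up D w v = flow_up D w w" by (rule invariant_coset[OF flow_up_invariant[OF w] W(1) vw(1)])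
  moreover have "flow_up D w w \<noteq> (\<lambda>_. 0)"
    using schubert_class_support[OF flow_up_schubert_class(1)[OF W(1)] W(1) W(1)] Bruhat_le_refl by blast
  ultimately have "Bruhat_le D w v"
    using schubert_class_support[OF flow_up_schubert_class(1)[OF W(1)] W(1) W(2)] by simp
  then have "w = v \<or> len D w < len D v" by (rule Bruhat_le_len)
  moreover have "len D v \<le> len D w" using v vw(2) by (simp add: min_reps_def)
  ultimately show "w = v" by auto
qed

lemma min_rep_exists:
  assumes "w \<in> Weyl D" obtains m where "m \<in> min_reps D J" "m \<in> coset D J w"
proof -
  obtain m where m: "m \<in> coset D J w" "\<And>x. x \<in> coset D J w \<Longrightarrow> len D m \<le> len D x"
    using ex_has_least_nat[of "\<lambda>x. x \<in> coset D J w" w "len D"] coset_self by blast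
  then have "m \<in> min_reps D J"
    using coset_Weyl[OF assms m(1)] coset_eq[OF m(1)] by (simp add: min_reps_def)
  with m(1) that show thesis by blast
qed

lemma invariant_closed:
  shows "(\<lambda>v\<in>Weyl D. \<lambda>_. 1) \<in> invariant_classes"
    and "p \<in> invariant_classes \<Longrightarrow> q \<in> invariant_classes \<Longrightarrow>
      (\<lambda>v\<in>Weyl D. \<lambda>h. p v h + q v h) \<in> invariant_classes"
    and "p \<in> invariant_classes \<Longrightarrow> q \<in> invariant_classes \<Longrightarrow>
      (\<lambda>v\<in>Weyl D. \<lambda>h. p v h * q v h) \<in> invariant_classes"
    and "c \<in> poly_funs D \<Longrightarrow> p \<in> invariant_classes \<Longrightarrow>
      (\<lambda>v\<in>Weyl D. \<lambda>h. c h * p v h) \<in> invariant_classes"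
proof -
  have W: "v \<circ> simple_refl j \<in> Weyl D" if "v \<in> Weyl D" "j \<in> J" for v j
    using that J by (auto intro!: Weyl_comp_simple)
  note closed = GKM_closed[of "\<lambda>w. w" "Weyl D", simplified, folded HT_GB_def]
  show "(\<lambda>v\<in>Weyl D. \<lambda>_. 1) \<in> invariant_classes"
    using closed(1) by (simp add: invariant_classes_def W)
  show "(\<lambda>v\<in>Weyl D. \<lambda>h. p v h + q v h) \<in> invariant_classes"
    if "p \<in> invariant_classes" "q \<in> invariant_classes"
    using that closed(2) by (simp add: invariant_classes_def W)
  show "(\<lambda>v\<in>Weyl D. \<lambda>h. p v h * q v h) \<in> invariant_classes"
    if "p \<in> invariant_classes" "q \<in> invariant_classes"
    using that closed(3) by (simp add: invariant_classes_def W)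
  show "(\<lambda>v\<in>Weyl D. \<lambda>h. c h * p v h) \<in> invariant_classes"
    if "c \<in> poly_funs D" "p \<in> invariant_classes"
    using that closed(4) by (simp add: invariant_classes_def W)
qed

lemma invariant_subset: "invariant_classes \<subseteq> carrier (HT_GB D)"
  by (auto simp: invariant_classes_def)

lemma invariantD: "p \<in> invariant_classes \<Longrightarrow> p \<in> Weyl D \<rightarrow>\<^sub>E poly_funs D"
  "p \<in> invariant_classes \<Longrightarrow> gkm p"
  using invariant_subset carrier_HT_GB by blast+

lemma algebra_invariant: "algebra (Sym D) (HT_GB D\<lparr>carrier := invariant_classes\<rparr>)"
  unfolding HT_GB_def
  by (rule algebra_GKM_subset) (use invariantD invariant_closed in auto)

lemma algebra_HT_GB: "algebra (Sym D) (HT_GB D)"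
  unfolding HT_GB_def by (rule algebra_GKM) simp

lemma algebra_HT_GP: "algebra (Sym D) (HT_GP D J)"
  unfolding HT_GP_def by (rule algebra_GKM) simp

lemma HT_GB_ops:
  "p \<oplus>\<^bsub>HT_GB D\<^esub> q = (\<lambda>v\<in>Weyl D. \<lambda>h. p v h + q v h)"
  "c \<odot>\<^bsub>HT_GB D\<^esub> p = (\<lambda>v\<in>Weyl D. \<lambda>h. c h * p v h)"
  by (simp_all add: HT_GB_def GKM_simps)

lemma submodule_invariant: "submodule invariant_classes (Sym D) (HT_GB D)"
  by (rule module.module_incl_imp_submodule[OF algebra.module[OF algebra_HT_GB] invariant_subset
        algebra.module[OF algebra_invariant]])

text \<open>
  Let \<open>v\<close> be a shortest element of a Bruhat-upper set that contains the support of an invariant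
  class \<open>q\<close>. If \<open>q v\<close> is nonzero, then \<open>v\<close> is a minimal representative and \<open>q v\<close> is divisible by the
  leading coefficient of the flow-up class of \<open>v\<close>; subtracting a multiple of it removes \<open>v\<close> from the
  upper set.
\<close>

lemma invariant_in_submodule:
  assumes N: "submodule N (Sym D) (HT_GB D)" "flow_up D ` min_reps D J \<subseteq> N"
    and U: "U \<subseteq> Weyl D" "\<And>x y. x \<in> U \<Longrightarrow> Bruhat_le D x y \<Longrightarrow> y \<in> U"
    and q: "q \<in> invariant_classes" "\<And>v. v \<in> Weyl D \<Longrightarrow> v \<notin> U \<Longrightarrow> q v = (\<lambda>_. 0)"
  shows "q \<in> N"
proof -
  interpret M: module "Sym D" "HT_GB D" by (rule algebra.module[OF algebra_HT_GB])
  note N_ops = M.submoduleE[OF N(1)]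
  have ext: "p = p'" if "p \<in> invariant_classes" "p' \<in> extensional (Weyl D)"
    "\<And>v. v \<in> Weyl D \<Longrightarrow> p v = p' v" for p p'
    using that invariantD(1)[OF that(1)] by (intro extensionalityI[of p "Weyl D" p']) (auto simp: PiE_def)
  have "finite U" using finite_subset[OF U(1) finite_Weyl] .
  then show ?thesis using U q
  proof (induction U arbitrary: q rule: finite_psubset_induct)
    case (psubset U)
    note U = psubset.prems(1,2) and q = psubset.prems(3,4)
    show ?case
    proof (cases "U = {}")
      case True
      obtain p where p: "p \<in> N" using N_ops(2) by blast
      have "(\<lambda>_. 0) \<odot>\<^bsub>HT_GB D\<^esub> p \<in> N"
        by (rule N_ops(4)[OF _ p]) (simp add: Sym_simps poly_funs.const)
      moreover have "q = (\<lambda>_. 0) \<odot>\<^bsub>HT_GB D\<^esub> p"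
        by (rule ext[OF q(1)]) (use q(2) True in \<open>auto simp: HT_GB_ops\<close>)
      ultimately show ?thesis by simp
    next
      case False
      then obtain v where v: "v \<in> U" "\<And>x. x \<in> U \<Longrightarrow> len D v \<le> len D x"
        using ex_has_least_nat[of "\<lambda>x. x \<in> U" _ "len D"] by blast
      have vW: "v \<in> Weyl D" using v(1) U(1) by blast
      have less: "U - {v} \<subset> U" using v(1) by blast
      have upper: "y \<in> U - {v}" if "x \<in> U - {v}" "Bruhat_le D x y" for x y
        using that U(2) Bruhat_le_len[OF that(2)] v(2)[of x] by auto
      show ?thesis
      proof (cases "q v = (\<lambda>_. 0)")
        case True
        show ?thesis
          by (rule psubset.IH[OF less _ upper q(1)]) (use U(1) q(2) True in auto)
      next
        case False
        have min: "v \<in> min_reps D J"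
          unfolding min_reps_def
        proof (intro CollectI conjI ballI vW)
          fix x assume x: "x \<in> coset D J v"
          have "q x \<noteq> (\<lambda>_. 0)" using invariant_coset[OF q(1) vW x] False by simp
          then have "x \<in> U" using q(2)[OF coset_Weyl[OF vW x]] by blast
          then show "len D v \<le> len D x" by (rule v(2))
        qed
        have lower: "q x = (\<lambda>_. 0)" if "x \<in> Weyl D" "len D x < len D v" for x
          using q(2)[OF that(1)] v(2)[of x] that(2) by auto
        obtain g where g: "g \<in> poly_funs D" "q v = (\<lambda>h. (\<Prod>\<alpha>\<in>inversions v. \<alpha> h) * g h)"
          using pos_roots_divide[OF finite_inversions inversions_pos
              gkm_poly[OF invariantD(2)[OF q(1)] vW] gkm_vanish_inversion[OF invariantD(2)[OF q(1)] vW lower]]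
          by blast
        let ?p = "flow_up D v"
        let ?r = "\<lambda>x\<in>Weyl D. \<lambda>h. q x h + (\<lambda>x\<in>Weyl D. \<lambda>h. - g h * ?p x h) x h"
        note p = flow_up_schubert_class(1)[OF vW]
        have r: "?r \<in> invariant_classes"
          by (rule invariant_closed(2)[OF q(1) invariant_closed(4)[OF poly_funs_uminus[OF g(1)]
                  flow_up_invariant[OF min]]])
        have "?r x = (\<lambda>_. 0)" if x: "x \<in> Weyl D" "x \<notin> U - {v}" for x
        proof (cases "x = v")
          case True
          then show ?thesis using schubert_classD(4)[OF p] g(2) vW by (simp add: algebra_simps)
        next
          case False
          with x(2) have "x \<notin> U" by blast
          moreover have "\<not> Bruhat_le D v x" using U(2)[OF v(1)] \<open>x \<notin> U\<close> by blast
          ultimately show ?thesis using q(2)[OF x(1)] schubert_classD(3)[OF p x(1)] x(1) by simp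
        qed
        then have rN: "?r \<in> N" by (intro psubset.IH[OF less _ upper r]) (use U(1) in blast)+
        have pN: "g \<odot>\<^bsub>HT_GB D\<^esub> ?p \<in> N"
          by (rule N_ops(4)) (use g(1) min N(2) in \<open>auto simp: Sym_simps\<close>)
        have "q = ?r \<oplus>\<^bsub>HT_GB D\<^esub> (g \<odot>\<^bsub>HT_GB D\<^esub> ?p)"
          by (rule ext[OF q(1)]) (auto simp: HT_GB_ops)
        then show ?thesis using N_ops(5)[OF rN pN] by simp
      qed
    qed
  qed
qed

lemma module_span_flow_up:
  "module_span (Sym D) (HT_GB D) (flow_up D ` min_reps D J) = invariant_classes"
proof
  show "module_span (Sym D) (HT_GB D) (flow_up D ` min_reps D J) \<subseteq> invariant_classes"
    unfolding module_span_def using submodule_invariant flow_up_invariant by blast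
  show "invariant_classes \<subseteq> module_span (Sym D) (HT_GB D) (flow_up D ` min_reps D J)"
  proof
    fix q assume q: "q \<in> invariant_classes"
    have "q \<in> N" if "submodule N (Sym D) (HT_GB D)" "flow_up D ` min_reps D J \<subseteq> N" for N
      by (rule invariant_in_submodule[OF that subset_refl _ q]) (use Bruhat_le_Weyl in blast)+
    then show "q \<in> module_span (Sym D) (HT_GB D) (flow_up D ` min_reps D J)"
      unfolding module_span_def by blast
  qed
qed

lemma restrict_reps_coset:
  assumes q: "q \<in> invariant_classes" and w: "w \<in> Weyl D"
  shows "restrict_reps D J q (coset D J w) = q w"
proof -
  obtain m where m: "m \<in> min_reps D J" "m \<in> coset D J w" using min_rep_exists[OF w] .
  have "the_inv_into (min_reps D J) (coset D J) (coset D J w) = m"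
    using the_inv_into_f_f[OF inj_on_coset m(1)] coset_eq[OF m(2)] by simp
  then show ?thesis using w invariant_coset[OF q w m(2)] by (simp add: restrict_reps_def)
qed

lemma restrict_reps_extensional: "restrict_reps D J q \<in> extensional (coset D J ` Weyl D)"
  by (simp add: restrict_reps_def)

lemma restrict_reps_eqI:
  assumes "q \<in> invariant_classes" "r \<in> extensional (coset D J ` Weyl D)"
    "\<And>w. w \<in> Weyl D \<Longrightarrow> r (coset D J w) = q w"
  shows "restrict_reps D J q = r"
  by (rule extensionalityI[OF restrict_reps_extensional assms(2)])
    (use restrict_reps_coset[OF assms(1)] assms(3) in auto)

text \<open>
  The inverse is the pull-back of functions along the map from \<open>W\<close> to the set of cosets.
\<close>

lemma restrict_reps_bij: "bij_betw (restrict_reps D J) invariant_classes (carrier (HT_GP D J))"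
proof (rule bij_betw_imageI)
  show "inj_on (restrict_reps D J) invariant_classes"
  proof (rule inj_onI)
    fix p q assume p: "p \<in> invariant_classes" and q: "q \<in> invariant_classes"
      and eq: "restrict_reps D J p = restrict_reps D J q"
    show "p = q"
    proof (rule extensionalityI[of _ "Weyl D"])
      show "p \<in> extensional (Weyl D)" "q \<in> extensional (Weyl D)"
        using invariantD(1) p q by (auto simp: PiE_def)
      show "p w = q w" if "w \<in> Weyl D" for w
        using restrict_reps_coset[OF p that] restrict_reps_coset[OF q that] eq by simp
    qed
  qed
  show "restrict_reps D J ` invariant_classes = carrier (HT_GP D J)"
  proof (intro equalityI subsetI)
    fix r assume "r \<in> restrict_reps D J ` invariant_classes"
    then obtain q where q: "q \<in> invariant_classes" "r = restrict_reps D J q" by blast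
    have gkm: "gkm (\<lambda>w. r (coset D J w))"
      by (rule gkm_cong[OF invariantD(2)[OF q(1)]]) (simp add: q restrict_reps_coset)
    have "r x \<in> poly_funs D" if "x \<in> coset D J ` Weyl D" for x
      using that gkm_poly[OF gkm] by (elim imageE) simp
    then have "r \<in> coset D J ` Weyl D \<rightarrow>\<^sub>E poly_funs D"
      unfolding PiE_def using restrict_reps_extensional[of q] q(2) by blast
    with gkm show "r \<in> carrier (HT_GP D J)" unfolding carrier_HT_GP by (rule conjI[rotated])
  next
    fix r assume r: "r \<in> carrier (HT_GP D J)"
    let ?q = "\<lambda>w\<in>Weyl D. r (coset D J w)"
    have "gkm (\<lambda>w. r (coset D J w))" using r by (simp add: carrier_HT_GP)
    then have gkm: "gkm ?q" by (rule gkm_cong) simp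
    have "?q (v \<circ> simple_refl j) = ?q v" if "v \<in> Weyl D" "j \<in> J" for v j
    proof -
      have "v \<circ> simple_refl j \<in> coset D J v" using parabolic_simple[OF that(2)] by (auto simp: coset_iff)
      from coset_eq[OF this] coset_Weyl[OF that(1) this] that(1) show ?thesis by (simp del: comp_apply)
    qed
    then have q: "?q \<in> invariant_classes"
      using gkm gkm_poly[OF gkm] unfolding invariant_classes_def carrier_HT_GB
      by (simp add: PiE_def Pi_def del: comp_apply)
    have "restrict_reps D J ?q = r"
      by (rule restrict_reps_eqI[OF q]) (use r in \<open>auto simp: carrier_HT_GP PiE_def\<close>)
    then have "r = restrict_reps D J ?q" by (rule sym)
    then show "r \<in> restrict_reps D J ` invariant_classes" using q by (rule image_eqI)
  qed
qed

lemma restrict_reps_iso: "restrict_reps D J \<in> algebra_iso (Sym D) (flow_up_span D J) (HT_GP D J)"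
proof -
  let ?f = "restrict_reps D J" and ?X = "coset D J ` Weyl D" and ?A = "invariant_classes"
  have ops: "carrier (flow_up_span D J) = ?A"
    "p \<otimes>\<^bsub>flow_up_span D J\<^esub> q = (\<lambda>v\<in>Weyl D. \<lambda>h. p v h * q v h)"
    "p \<oplus>\<^bsub>flow_up_span D J\<^esub> q = (\<lambda>v\<in>Weyl D. \<lambda>h. p v h + q v h)"
    "\<one>\<^bsub>flow_up_span D J\<^esub> = (\<lambda>v\<in>Weyl D. \<lambda>_. 1)"
    "c \<odot>\<^bsub>flow_up_span D J\<^esub> p = (\<lambda>v\<in>Weyl D. \<lambda>h. c h * p v h)" for p q c
    by (simp_all add: flow_up_span_def module_span_flow_up) (simp_all add: HT_GB_def GKM_simps)
  have ops': "p \<otimes>\<^bsub>HT_GP D J\<^esub> q = (\<lambda>x\<in>?X. \<lambda>h. p x h * q x h)"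
    "p \<oplus>\<^bsub>HT_GP D J\<^esub> q = (\<lambda>x\<in>?X. \<lambda>h. p x h + q x h)"
    "\<one>\<^bsub>HT_GP D J\<^esub> = (\<lambda>x\<in>?X. \<lambda>_. 1)"
    "c \<odot>\<^bsub>HT_GP D J\<^esub> p = (\<lambda>x\<in>?X. \<lambda>h. c h * p x h)" for p q c
    by (simp_all add: HT_GP_def GKM_simps)
  have "?f \<in> ring_hom (flow_up_span D J) (HT_GP D J)"
  proof (rule ring_hom_memI)
    show "?f p \<in> carrier (HT_GP D J)" if "p \<in> carrier (flow_up_span D J)" for p
      using that bij_betwE[OF restrict_reps_bij] by (simp add: ops)
    show "?f (p \<otimes>\<^bsub>flow_up_span D J\<^esub> q) = ?f p \<otimes>\<^bsub>HT_GP D J\<^esub> ?f q"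
      "?f (p \<oplus>\<^bsub>flow_up_span D J\<^esub> q) = ?f p \<oplus>\<^bsub>HT_GP D J\<^esub> ?f q"
      if "p \<in> carrier (flow_up_span D J)" "q \<in> carrier (flow_up_span D J)" for p q
      using that unfolding ops ops'
      by (auto intro!: restrict_reps_eqI invariant_closed simp: restrict_reps_coset)
    show "?f \<one>\<^bsub>flow_up_span D J\<^esub> = \<one>\<^bsub>HT_GP D J\<^esub>"
      unfolding ops ops' by (auto intro!: restrict_reps_eqI invariant_closed)
  qed
  moreover have "?f (c \<odot>\<^bsub>flow_up_span D J\<^esub> p) = c \<odot>\<^bsub>HT_GP D J\<^esub> ?f p"
    if "c \<in> carrier (Sym D)" "p \<in> carrier (flow_up_span D J)" for c p
    using that unfolding ops ops' Sym_simps
    by (auto intro!: restrict_reps_eqI invariant_closed simp: restrict_reps_coset)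
  ultimately show ?thesis
    using restrict_reps_bij by (simp add: algebra_iso_def ring_iso_def ops)
qed

end

theorem corollary7p4:
  fixes D :: "('t::ab_group_add) root_data" and J :: "nat set"
  assumes "semisimple_root_data D"
    and "J \<subseteq> {1..rank D}"
  shows "algebra (Sym D) (HT_GB D) \<and>
    algebra (Sym D) (HT_GP D J) \<and>
    algebra (Sym D) (flow_up_span D J) \<and>
    carrier (flow_up_span D J) \<subseteq> carrier (HT_GB D) \<and>
    restrict_reps D J \<in> algebra_iso (Sym D) (flow_up_span D J) (HT_GP D J)"
proof -
  interpret parabolic D J by unfold_locales (fact assms)+
  have "flow_up_span D J = HT_GB D\<lparr>carrier := invariant_classes\<rparr>"
    by (simp add: flow_up_span_def module_span_flow_up)
  then show ?thesis
    using algebra_HT_GB algebra_HT_GP algebra_invariant invariant_subset restrict_reps_iso by simp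
qed

end
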